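(* Suppose: (i) the directed graph $\mathcal G$ is strongly connected and $W=[w_{ij}]\in\mathbb R^{n\times n}$ is a nonnegative doubly stochastic weight matrix for it ($W\mathbf 1_n=\mathbf 1_n$, $\mathbf 1_n^TW=\mathbf 1_n^T$, $w_{ii}>0$ for all $i$, and for $i\neq j$, $w_{ij}>0$ if agent $i$ can receive information from agent $j$ and $w_{ij}=0$ otherwise); (ii) there is $L_f>0$ with $\|\nabla F_i(X)-\nabla F_i(Y)\|\le L_f\|X-Y\|$ for all $X,Y\in\mathbb R^d$ and all $i\in\mathcal V$; (iii) $F$ satisfies the Polyak--Łojasiewicz condition with constant $\nu>0$: $\frac12\|\nabla F(X)\|^2\ge\nu(F(X)-F^\star)$ for all $X\in\mathbb R^d$; (iv) the compressor $\mathcal C:\mathbb R^d\to\mathbb R^d$ satisfies, for some constants $r>0$ and $\psi\in(0,1]$, $\mathbf E_{\mathcal C}\big[\|\mathcal C(X)/r-X\|^2\big]\le(1-\psi)\|X\|^2$ for all $X\in\mathbb R^d$. Let every agent run Algorithm 1 (defined in the context) with $\varphi_X,\varphi_Y\in(0,\frac1r)$ and, with $c_1=\frac{\varphi_X\psi r}{2}$, $c_2=\frac{\varphi_Y\psi r}{2}$, $C=2r^2(1-\psi)+2(1-r)^2$, with $$\gamma\in\Big(0,\min\Big\{\tfrac{1-\sigma}{160(1+c_1^{-1})},\tfrac{1-\sigma}{40000(1+c_2^{-1})L_f^2},\tfrac{c_1(1-\sigma)}{40C},\tfrac{c_1}{8\sqrt C},\tfrac{c_1}{10L_f\sqrt{C(1+c_2^{-1})}},\tfrac{c_2L_f^2}{C},\tfrac{c_2}{10\sqrt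 C}\Big\}\Big),$$ $$\eta\in\Big(0,\min\Big\{\tfrac{(1-\sigma)^2\gamma}{40L_f},\tfrac{0.4(1-\sigma)\gamma}{L_f^2},\tfrac{(1-\sigma)^2}{80L_f}\sqrt{\tfrac{\gamma}{1+c_1^{-1}}},\tfrac{9}{40(4(1+c_1^{-1})+5(1+c_2^{-1}))},\tfrac1{2L_f},\gamma\Big\}\Big).$$ Then for every $k\ge0$, $$\mathbf E_{\mathcal C}\big[\|\boldsymbol X(k)-\bar{\boldsymbol X}(k)\|^2+n(F(\bar X(k))-F^\star)\big]\le(1-\theta_4)^kU(0),$$ where $\theta_4=\min\{\theta_3,2\nu\theta_2\}$, $\theta_2=\frac\eta4-(\phi\varepsilon_1+\varepsilon_2+\varepsilon_3)$, $\theta_3=\min\{0.07(1-\sigma)\gamma,\ 0.44c_1(2c_1+1),\ 0.77c_2(2c_2+1)\}$, $\varepsilon_1=\frac{8L_f^2}{(1-\sigma)\gamma}\eta^2$, $\varepsilon_2=4(1+c_1^{-1})\eta^2$, $\varepsilon_3=5(1+c_2^{-1})\eta^2$.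
   Context: Problem. A group of $n$ agents $\mathcal V=\{1,\dots,n\}$ communicates over a directed graph $\mathcal G=(\mathcal V,\mathcal E)$. Agent $i$ has a differentiable (possibly nonconvex) cost $F_i:\mathbb R^d\to\mathbb R$; $F=\frac1n\sum_{i=1}^nF_i$; the set $\operatorname{argmin}F$ is nonempty and $F^\star=\min F>-\infty$. $\|\cdot\|$ is the Euclidean norm (spectral norm for matrices). $\sigma\in(0,1)$ denotes the spectral norm of $W-\frac1n\mathbf 1_n\mathbf 1_n^T$. Compressor. $\mathcal C$ is a possibly randomized map; $\mathbf E_{\mathcal C}$ is expectation over its internal randomness. Each application of $\mathcal C$ in the algorithm uses fresh randomness, independent of the past. Algorithm 1. Parameters $\gamma,\eta,\varphi_X,\varphi_Y>0$. Initialization for each $i\in\mathcal V$: $X_i(0)\in\mathbb R^d$ arbitrary, $Y_i(0)=\nabla F_i(X_i(0))$, $A_i(0)=B_i(0)=C_i(0)=D_i(0)=\mathbf 0_d$, $Q_i^X(0)=\mathcal C(X_i(0))$, $Q_i^Y(0)=\mathcal C(Y_i(0))$. For $k\ge0$ and each $i$: $A_i(k+1)=A_i(k)+\varphi_XQ_i^X(k)$; $B_i(k+1)=B_i(k)+\varphi_X\big(Q_i^X(k)-\sum_jw_{ij}Q_j^X(k)\big)$; $C_i(k+1)=C_i(k)+\varphi_YQ_i^Y(k)$; $D_i(k+1)=D_i(k)+\varphi_Y\big(Q_i^Y(k)-\sum_jw_{ij}Q_j^Y(k)\big)$; $X_i(k+1)=X_i(k)-\gamma\big[B_i(k)+Q_i^X(k)-\sum_jw_{ij}Q_j^X(k)\big]-\eta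 Y_i(k)$; $Y_i(k+1)=Y_i(k)-\gamma\big[D_i(k)+Q_i^Y(k)-\sum_jw_{ij}Q_j^Y(k)\big]+\nabla F_i(X_i(k+1))-\nabla F_i(X_i(k))$; $Q_i^X(k+1)=\mathcal C(X_i(k+1)-A_i(k+1))$; $Q_i^Y(k+1)=\mathcal C(Y_i(k+1)-C_i(k+1))$. Notation. $\boldsymbol X,\boldsymbol Y,\boldsymbol A,\boldsymbol C\in\mathbb R^{nd}$ are the stacked vectors of $X_i,Y_i,A_i,C_i$; $\bar X(k)=\frac1n\sum_iX_i(k)$; $\bar{\boldsymbol X}(k)=\mathbf 1_n\otimes\bar X(k)$; $\bar{\boldsymbol Y}(k)=\mathbf 1_n\otimes\frac1n\sum_iY_i(k)$. With $\phi=\frac{(1-\sigma)^2}{320L_f^2}$, $$V(k)=\|\boldsymbol X(k)-\bar{\boldsymbol X}(k)\|^2+\phi\|\boldsymbol Y(k)-\bar{\boldsymbol Y}(k)\|^2+\|\boldsymbol X(k)-\boldsymbol A(k)\|^2+\|\boldsymbol Y(k)-\boldsymbol C(k)\|^2,$$ $$U(k)=V(k)+n(F(\bar X(k))-F^\star).$$ *)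

theory Defs
  imports "HOL-Probability.Probability"
begin

text \<open>Agents are the elements of a finite type \<open>'n\<close>, so \<open>n = CARD('n)\<close>. A stacked vector
  is an element of \<open>(real ^ 'd) ^ 'n\<close>; its library norm is the Euclidean norm of the
  concatenated vector.\<close>

subsection \<open>Graph and weight matrix\<close>

text \<open>\<open>(j, i) \<in> E\<close> means that agent \<open>i\<close> can receive information from agent \<open>j\<close>.\<close>

definition strongly_connected :: "('n \<times> 'n) set \<Rightarrow> bool" where
  "strongly_connected E \<longleftrightarrow> (\<forall>i j. (i, j) \<in> E\<^sup>*)"

text \<open>In the stochasticity conditions \<open>1\<close> is the all-ones vector.\<close>

definition doubly_stochastic_weights :: "('n::finite \<times> 'n) set \<Rightarrow> real ^ 'n ^ 'n \<Rightarrow> bool" where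
  "doubly_stochastic_weights E W \<longleftrightarrow>
     (\<forall>i j. 0 \<le> W $ i $ j) \<and> W *v 1 = 1 \<and> 1 v* W = 1 \<and>
     (\<forall>i. 0 < W $ i $ i) \<and>
     (\<forall>i j. i \<noteq> j \<longrightarrow> (if (j, i) \<in> E then 0 < W $ i $ j else W $ i $ j = 0))"

definition spectral_norm :: "real ^ 'n ^ 'm \<Rightarrow> real" where
  "spectral_norm A = onorm (\<lambda>x. A *v x)"

subsection \<open>Costs\<close>

text \<open>Meaningful wherever \<open>f\<close> is differentiable.\<close>

definition grad :: "('a::euclidean_space \<Rightarrow> real) \<Rightarrow> 'a \<Rightarrow> 'a" where
  "grad f x = (THE D. GDERIV f x :> D)"

definition mean_cost :: "('n::finite \<Rightarrow> 'a \<Rightarrow> real) \<Rightarrow> 'a \<Rightarrow> real" where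
  "mean_cost F x = (1 / real CARD('n)) * (\<Sum>i\<in>UNIV. F i x)"

definition argmin :: "('a \<Rightarrow> real) \<Rightarrow> 'a set" where
  "argmin f = {x. \<forall>y. f x \<le> f y}"

text \<open>This is the minimum of \<open>f\<close> whenever \<open>argmin f\<close> is nonempty.\<close>

definition min_value :: "('a \<Rightarrow> real) \<Rightarrow> real" where
  "min_value f = (INF x. f x)"

definition PL_condition :: "('a::euclidean_space \<Rightarrow> real) \<Rightarrow> real \<Rightarrow> bool" where
  "PL_condition f \<nu> \<longleftrightarrow>
     (\<forall>x. (1 / 2) * (norm (grad f x))\<^sup>2 \<ge> \<nu> * (f x - min_value f))"

subsection \<open>Randomized compressor\<close>

text \<open>A randomized map is a function of a random seed with law \<open>S\<close> and of the input. The
  integrability clause is part of the claim that the expected error is bounded, because the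
  Bochner integral of a non-integrable function is \<open>0\<close>.\<close>

definition randomized_map :: "'s measure \<Rightarrow> ('s \<Rightarrow> 'a::euclidean_space \<Rightarrow> 'a) \<Rightarrow> bool" where
  "randomized_map S cmp \<longleftrightarrow>
     prob_space S \<and> (\<lambda>(s, x). cmp s x) \<in> (S \<Otimes>\<^sub>M borel) \<rightarrow>\<^sub>M borel"

definition contractive_compressor ::
  "'s measure \<Rightarrow> ('s \<Rightarrow> 'a::euclidean_space \<Rightarrow> 'a) \<Rightarrow> real \<Rightarrow> real \<Rightarrow> bool" where
  "contractive_compressor S cmp r \<psi> \<longleftrightarrow>
     (\<forall>x. integrable S (\<lambda>s. (norm (cmp s x /\<^sub>R r - x))\<^sup>2) \<and>
          (\<integral>s. (norm (cmp s x /\<^sub>R r - x))\<^sup>2 \<partial>S) \<le> (1 - \<psi>) * (norm x)\<^sup>2)"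

text \<open>Seed \<open>(k, i, c)\<close> is used by agent \<open>i\<close> at time \<open>k\<close> for the compression producing
  \<open>Q\<^sup>X\<close> or \<open>Q\<^sup>Y\<close>.\<close>

datatype channel = XChan | YChan

type_synonym 'n seed_index = "nat \<times> 'n \<times> channel"

definition past :: "nat \<Rightarrow> 'n seed_index set" where
  "past k = {..<k} \<times> UNIV \<times> UNIV"

text \<open>Each seed has law \<open>S\<close>, and the sigma-algebra it generates is independent of the one
  generated jointly by all seeds used at strictly earlier times. No independence between seeds
  used at the same time is required; mutually independent seeds are a special case.\<close>

definition fresh_seeds ::
  "'w measure \<Rightarrow> 's measure \<Rightarrow> ('n seed_index \<Rightarrow> 'w \<Rightarrow> 's) \<Rightarrow> bool" where
  "fresh_seeds M S \<zeta> \<longleftrightarrow>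
     (\<forall>p. \<zeta> p \<in> M \<rightarrow>\<^sub>M S \<and> distr M S (\<zeta> p) = S) \<and>
     (\<forall>k i c. prob_space.indep_set M
        (sets (vimage_algebra (space M) (\<zeta> (k, i, c)) S))
        (sets (vimage_algebra (space M) (\<lambda>\<omega>. \<lambda>q\<in>past k. \<zeta> q \<omega>) (PiM (past k) (\<lambda>_. S)))))"

subsection \<open>The algorithm\<close>

record ('d, 'n) alg_state =
  stX :: "real ^ 'd ^ 'n"
  stY :: "real ^ 'd ^ 'n"
  stA :: "real ^ 'd ^ 'n"
  stB :: "real ^ 'd ^ 'n"
  stC :: "real ^ 'd ^ 'n"
  stD :: "real ^ 'd ^ 'n"
  stQX :: "real ^ 'd ^ 'n"
  stQY :: "real ^ 'd ^ 'n"

definition stacked_grad ::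
  "('n::finite \<Rightarrow> real ^ 'd \<Rightarrow> real) \<Rightarrow> real ^ 'd ^ 'n \<Rightarrow> real ^ 'd ^ 'n" where
  "stacked_grad F X = (\<chi> i. grad (F i) (X $ i))"

definition mix_residual :: "real ^ 'n ^ 'n \<Rightarrow> real ^ 'd ^ 'n \<Rightarrow> real ^ 'd ^ 'n" where
  "mix_residual W Q = (\<chi> i. Q $ i - (\<Sum>j\<in>UNIV. (W $ i $ j) *\<^sub>R (Q $ j)))"

definition compress ::
  "('s \<Rightarrow> real ^ 'd \<Rightarrow> real ^ 'd) \<Rightarrow> ('n \<Rightarrow> 's) \<Rightarrow> real ^ 'd ^ 'n \<Rightarrow> real ^ 'd ^ 'n" where
  "compress cmp u Z = (\<chi> i. cmp (u i) (Z $ i))"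

definition alg_init ::
  "('s \<Rightarrow> real ^ 'd \<Rightarrow> real ^ 'd) \<Rightarrow> ('n::finite \<Rightarrow> real ^ 'd \<Rightarrow> real) \<Rightarrow> real ^ 'd ^ 'n \<Rightarrow>
   ('n \<Rightarrow> 's) \<Rightarrow> ('n \<Rightarrow> 's) \<Rightarrow> ('d, 'n) alg_state" where
  "alg_init cmp F X0 u v =
     \<lparr> stX = X0, stY = stacked_grad F X0, stA = 0, stB = 0, stC = 0, stD = 0,
       stQX = compress cmp u X0, stQY = compress cmp v (stacked_grad F X0) \<rparr>"

definition alg_step ::
  "('s \<Rightarrow> real ^ 'd \<Rightarrow> real ^ 'd) \<Rightarrow> real ^ 'n ^ 'n \<Rightarrow> ('n::finite \<Rightarrow> real ^ 'd \<Rightarrow> real) \<Rightarrow>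
   real \<Rightarrow> real \<Rightarrow> real \<Rightarrow> real \<Rightarrow>
   ('n \<Rightarrow> 's) \<Rightarrow> ('n \<Rightarrow> 's) \<Rightarrow> ('d, 'n) alg_state \<Rightarrow> ('d, 'n) alg_state" where
  "alg_step cmp W F \<gamma> \<eta> \<phi>\<^sub>X \<phi>\<^sub>Y u v s =
    (let A' = stA s + \<phi>\<^sub>X *\<^sub>R stQX s;
         B' = stB s + \<phi>\<^sub>X *\<^sub>R mix_residual W (stQX s);
         C' = stC s + \<phi>\<^sub>Y *\<^sub>R stQY s;
         D' = stD s + \<phi>\<^sub>Y *\<^sub>R mix_residual W (stQY s);
         X' = stX s - \<gamma> *\<^sub>R (stB s + mix_residual W (stQX s)) - \<eta> *\<^sub>R stY s;
         Y' = stY s - \<gamma> *\<^sub>R (stD s + mix_residual W (stQY s))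
                + stacked_grad F X' - stacked_grad F (stX s)
     in \<lparr> stX = X', stY = Y', stA = A', stB = B', stC = C', stD = D',
          stQX = compress cmp u (X' - A'), stQY = compress cmp v (Y' - C') \<rparr>)"

primrec alg_run ::
  "('s \<Rightarrow> real ^ 'd \<Rightarrow> real ^ 'd) \<Rightarrow> real ^ 'n ^ 'n \<Rightarrow> ('n::finite \<Rightarrow> real ^ 'd \<Rightarrow> real) \<Rightarrow>
   real \<Rightarrow> real \<Rightarrow> real \<Rightarrow> real \<Rightarrow> real ^ 'd ^ 'n \<Rightarrow>
   ('n seed_index \<Rightarrow> 's) \<Rightarrow> nat \<Rightarrow> ('d, 'n) alg_state" where
  "alg_run cmp W F \<gamma> \<eta> \<phi>\<^sub>X \<phi>\<^sub>Y X0 z 0 =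
     alg_init cmp F X0 (\<lambda>i. z (0, i, XChan)) (\<lambda>i. z (0, i, YChan))"
| "alg_run cmp W F \<gamma> \<eta> \<phi>\<^sub>X \<phi>\<^sub>Y X0 z (Suc k) =
     alg_step cmp W F \<gamma> \<eta> \<phi>\<^sub>X \<phi>\<^sub>Y (\<lambda>i. z (Suc k, i, XChan)) (\<lambda>i. z (Suc k, i, YChan))
       (alg_run cmp W F \<gamma> \<eta> \<phi>\<^sub>X \<phi>\<^sub>Y X0 z k)"

subsection \<open>Lyapunov functions\<close>

definition avg :: "real ^ 'd ^ 'n \<Rightarrow> real ^ 'd" where
  "avg X = (1 / real CARD('n)) *\<^sub>R (\<Sum>i\<in>UNIV. X $ i)"

definition rep_avg :: "real ^ 'd ^ 'n \<Rightarrow> real ^ 'd ^ 'n" where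
  "rep_avg X = (\<chi> i. avg X)"

definition optimality_gap ::
  "('n::finite \<Rightarrow> real ^ 'd \<Rightarrow> real) \<Rightarrow> real ^ 'd ^ 'n \<Rightarrow> real" where
  "optimality_gap F X =
     real CARD('n) * (mean_cost F (avg X) - min_value (mean_cost F))"

definition V_fun :: "real \<Rightarrow> real ^ 'd ^ 'n \<Rightarrow> real ^ 'd ^ 'n \<Rightarrow> real ^ 'd ^ 'n \<Rightarrow> real ^ 'd ^ 'n \<Rightarrow> real" where
  "V_fun \<phi> X Y A C =
     (norm (X - rep_avg X))\<^sup>2 + \<phi> * (norm (Y - rep_avg Y))\<^sup>2
       + (norm (X - A))\<^sup>2 + (norm (Y - C))\<^sup>2"

definition U_fun ::
  "('n::finite \<Rightarrow> real ^ 'd \<Rightarrow> real) \<Rightarrow> real \<Rightarrow>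
   real ^ 'd ^ 'n \<Rightarrow> real ^ 'd ^ 'n \<Rightarrow> real ^ 'd ^ 'n \<Rightarrow> real ^ 'd ^ 'n \<Rightarrow> real" where
  "U_fun F \<phi> X Y A C = V_fun \<phi> X Y A C + optimality_gap F X"

subsection \<open>Step size bounds\<close>

text \<open>The constant \<open>C\<close> vanishes when \<open>r = 1\<close> and \<open>\<psi> = 1\<close>. Each quotient that has it in the
  denominator is therefore formed in the extended reals, where a positive number divided by
  \<open>0\<close> is \<open>\<infinity>\<close>, so that the corresponding bound is void; in the reals it would be \<open>0\<close>.\<close>

definition gamma_bound :: "real \<Rightarrow> real \<Rightarrow> real \<Rightarrow> real \<Rightarrow> real \<Rightarrow> ereal" where
  "gamma_bound \<sigma> L\<^sub>f c\<^sub>1 c\<^sub>2 C = Min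
     { ereal ((1 - \<sigma>) / (160 * (1 + inverse c\<^sub>1))),
       ereal ((1 - \<sigma>) / (40000 * (1 + inverse c\<^sub>2) * L\<^sub>f\<^sup>2)),
       ereal (c\<^sub>1 * (1 - \<sigma>)) / ereal (40 * C),
       ereal c\<^sub>1 / ereal (8 * sqrt C),
       ereal c\<^sub>1 / ereal (10 * L\<^sub>f * sqrt (C * (1 + inverse c\<^sub>2))),
       ereal (c\<^sub>2 * L\<^sub>f\<^sup>2) / ereal C,
       ereal c\<^sub>2 / ereal (10 * sqrt C) }"

definition eta_bound :: "real \<Rightarrow> real \<Rightarrow> real \<Rightarrow> real \<Rightarrow> real \<Rightarrow> real" where
  "eta_bound \<sigma> L\<^sub>f c\<^sub>1 c\<^sub>2 \<gamma> = Min
     { (1 - \<sigma>)\<^sup>2 * \<gamma> / (40 * L\<^sub>f),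
       0.4 * (1 - \<sigma>) * \<gamma> / L\<^sub>f\<^sup>2,
       (1 - \<sigma>)\<^sup>2 / (80 * L\<^sub>f) * sqrt (\<gamma> / (1 + inverse c\<^sub>1)),
       9 / (40 * (4 * (1 + inverse c\<^sub>1) + 5 * (1 + inverse c\<^sub>2))),
       1 / (2 * L\<^sub>f),
       \<gamma> }"

end

theory Submission
  imports Defs
begin

text \<open>Write \<open>L = I - W\<close>. Since \<open>B = L A\<close> and \<open>D = L C\<close> along the run, both \<open>X\<close> and \<open>Y\<close> follow a
  damped consensus iteration \<open>x' = x - \<gamma> L x - \<gamma> L n + h\<close>, where \<open>n = Q - e\<close> is the noise of the
  compression of the error \<open>e\<close> (\<open>e = X - A\<close> or \<open>e = Y - C\<close>). A mean-square bound on \<open>n\<close> and the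
  descent of \<open>F\<close> at the average give a linear recursion for the terms of \<open>U\<close>. It contracts
  because the dissipation \<open>d = \<langle>x, L x\<rangle>\<close> dominates \<open>(1 - \<sigma>) |x|\<^sup>2\<close>, \<open>|L x|\<^sup>2 / 2\<close> and
  \<open>|L\<^sup>T x|\<^sup>2 / 2\<close>, so that the compression noise costs no factor \<open>1 / (1 - \<sigma>)\<close>.
  The recursion holds along each path up to multiples of \<open>|Q / r - e|\<^sup>2 - (1 - \<psi>) |e|\<^sup>2\<close>, whose
  expectation is nonpositive because the seed is independent of \<open>e\<close>.\<close>

text \<open>The recursions are coupled through the displacement \<open>X' - X\<close>. Its square
  \<open>D\<close> drives the tracking error through the Lipschitz gradients, and both compression
  errors because their targets move; conversely \<open>D\<close> contains the consensus errors, the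
  noise and the mean gradient. The total weight \<open>K\<close> of \<open>D\<close> satisfies
  \<open>\<gamma> * K \<le> 0.0127 * (1 - \<sigma>)\<close>, so each feedback is a small share of
  the damping it meets. The mean gradient is no term of the Lyapunov function; it is paid by a
  negative term that the descent of \<open>F\<close> leaves over. The dissipation of
  \<open>Y\<close> also has to pay for the drift of the compression error of \<open>Y\<close>. It is
  therefore carried along as a quantity of its own and bounded from below only after that payment.
  Since the pathwise estimates are linear in the signed excess of the compression errors,
  probability enters at one point only: the expected excess of a single compression. Integrability
  is derived along with the bounds, because the Bochner integral of a non-integrable function is
  0.\<close>

section \<open>Elementary norm inequalities\<close>

lemma norm_add_sq_le:
  fixes u v :: "'a::real_inner"
  assumes "0 < c"
  shows "(norm (u + v))\<^sup>2 \<le> (1 + c) * (norm u)\<^sup>2 + (1 + inverse c) * (norm v)\<^sup>2"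
proof -
  have "0 \<le> (norm (c *\<^sub>R u - v))\<^sup>2" by simp
  also have "\<dots> = c * (c * (norm u)\<^sup>2) - c * (2 * (u \<bullet> v)) + (norm v)\<^sup>2"
    by (simp add: power2_norm_eq_inner inner_diff_left inner_diff_right inner_commute)
  finally have "0 \<le> inverse c * (c * (c * (norm u)\<^sup>2) - c * (2 * (u \<bullet> v)) + (norm v)\<^sup>2)"
    using assms by simp
  also have "\<dots> = c * (norm u)\<^sup>2 - 2 * (u \<bullet> v) + inverse c * (norm v)\<^sup>2"
    using assms by (simp add: distrib_left right_diff_distrib flip: mult.assoc)
  finally show ?thesis
    by (simp add: power2_norm_eq_inner inner_add_left inner_add_right inner_commute distrib_right)
qed

lemma norm_sum_sq_le:
  fixes f :: "'i \<Rightarrow> 'a::real_normed_vector"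
  assumes "finite I"
  shows "(norm (\<Sum>i\<in>I. f i))\<^sup>2 \<le> real (card I) * (\<Sum>i\<in>I. (norm (f i))\<^sup>2)"
proof -
  have "(norm (\<Sum>i\<in>I. f i))\<^sup>2 \<le> (\<Sum>i\<in>I. norm (f i))\<^sup>2"
    by (intro power_mono norm_sum) auto
  also have "\<dots> \<le> real (card I) * (\<Sum>i\<in>I. (norm (f i))\<^sup>2)"
    using Cauchy_Schwarz_ineq_sum[of "\<lambda>_. 1" "\<lambda>i. norm (f i)" I] by simp
  finally show ?thesis .
qed

lemma norm_add3_sq_le:
  fixes u v w :: "'a::real_normed_vector"
  shows "(norm (u + v + w))\<^sup>2 \<le> 3 * ((norm u)\<^sup>2 + (norm v)\<^sup>2 + (norm w)\<^sup>2)"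
  using norm_sum_sq_le[of "{..<3::nat}" "\<lambda>i. [u, v, w] ! i"]
  by (simp add: numeral_3_eq_3 lessThan_Suc algebra_simps)

lemma norm_add4_sq_le:
  fixes t u v w :: "'a::real_normed_vector"
  shows "(norm (t + u + v + w))\<^sup>2 \<le> 4 * ((norm t)\<^sup>2 + (norm u)\<^sup>2 + (norm v)\<^sup>2 + (norm w)\<^sup>2)"
  using norm_sum_sq_le[of "{..<4::nat}" "\<lambda>i. [t, u, v, w] ! i"]
  by (simp add: eval_nat_numeral lessThan_Suc algebra_simps)

lemma norm_vec_sq: "(norm x)\<^sup>2 = (\<Sum>i\<in>UNIV. (norm (x $ i))\<^sup>2)"
  for x :: "'a::real_normed_vector ^ 'n::finite"
  by (simp add: norm_vec_def L2_set_def sum_nonneg)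

section \<open>Damped iteration of a contraction\<close>

locale contraction_map =
  fixes T :: "'a::euclidean_space \<Rightarrow> 'a" and \<sigma> :: real
  assumes lin: "linear T" and \<sigma>_less_1: "\<sigma> < 1" and \<sigma>_nonneg: "0 \<le> \<sigma>"
    and norm_T: "\<And>x. norm (T x) \<le> \<sigma> * norm x"
begin

lemma norm_T_le: "norm (T x) \<le> norm x"
  using norm_T[of x] \<sigma>_less_1 \<sigma>_nonneg mult_left_le_one_le[of "norm x" \<sigma>] by simp

text \<open>The squared norm equals \<open>x \<bullet> T (adjoint T x)\<close>; Cauchy-Schwarz
  leaves one factor \<open>norm (adjoint T x)\<close>, which cancels when nonzero.\<close>

lemma norm_adjoint_le: "norm (adjoint T x) \<le> norm x"
proof (cases "adjoint T x = 0")
  case False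
  have "(norm (adjoint T x))\<^sup>2 = x \<bullet> T (adjoint T x)"
    by (simp add: power2_norm_eq_inner adjoint_works[OF lin] inner_commute)
  also have "\<dots> \<le> norm x * norm (T (adjoint T x))" by (rule norm_cauchy_schwarz)
  also have "\<dots> \<le> norm x * norm (adjoint T x)"
    by (intro mult_left_mono norm_T_le) auto
  finally show ?thesis using False by (simp add: power2_eq_square)
qed simp

lemma dissipation_ge: "(1 - \<sigma>) * (norm y)\<^sup>2 \<le> y \<bullet> (y - T y)"
proof -
  have "y \<bullet> T y \<le> norm y * norm (T y)" by (rule norm_cauchy_schwarz)
  also have "\<dots> \<le> norm y * (\<sigma> * norm y)" by (intro mult_left_mono norm_T) auto
  finally show ?thesis by (simp add: inner_diff_right power2_norm_eq_inner[symmetric] power2_eq_square algebra_simps)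
qed

text \<open>In the expanded square, nonexpansiveness replaces the square of \<open>T y\<close> by
  that of \<open>y\<close>; what remains is twice the dissipation.\<close>

lemma norm_residual_sq_le: "(norm (y - T y))\<^sup>2 \<le> 2 * (y \<bullet> (y - T y))"
proof -
  have "(norm (T y))\<^sup>2 \<le> (norm y)\<^sup>2" using norm_T_le by (intro power_mono) auto
  then show ?thesis
    by (simp add: power2_norm_eq_inner inner_diff_left inner_diff_right inner_commute)
qed

text \<open>The same expansion works since \<open>T\<close> and its adjoint have the same quadratic
  form.\<close>

lemma norm_adjoint_residual_sq_le: "(norm (y - adjoint T y))\<^sup>2 \<le> 2 * (y \<bullet> (y - T y))"
proof -
  have "(norm (adjoint T y))\<^sup>2 \<le> (norm y)\<^sup>2" using norm_adjoint_le by (intro power_mono) auto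
  moreover have "y \<bullet> adjoint T y = y \<bullet> T y"
    by (simp add: adjoint_works[OF lin] inner_commute)
  ultimately show ?thesis
    by (simp add: power2_norm_eq_inner inner_diff_left inner_diff_right inner_commute)
qed

lemma norm_residual_le: "norm (y - T y) \<le> 2 * norm y"
  using norm_triangle_ineq4[of y "T y"] norm_T_le[of y] by simp

text \<open>The cross term with the noise is moved to the adjoint side, where Young's inequality
  charges it \<open>d / 2\<close> and \<open>4 * (norm n)\<^sup>2\<close>. As
  \<open>\<gamma> \<le> 1 / 480\<close>, the second-order term costs only \<open>d / 100\<close> and
  \<open>(norm n)\<^sup>2 / 50\<close>. Hence \<open>2 - 1/2 - 1/100 = 149/100\<close> and
  \<open>4 + 1/50 = 402/100\<close>.\<close>

lemma damped_step:
  assumes \<gamma>: "0 < \<gamma>" "\<gamma> \<le> 1 / 480"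
  shows "(norm (y - \<gamma> *\<^sub>R (y - T y) - \<gamma> *\<^sub>R (n - T n)))\<^sup>2
    \<le> (norm y)\<^sup>2 - (149 / 100) * \<gamma> * (y \<bullet> (y - T y)) + (402 / 100) * \<gamma> * (norm n)\<^sup>2"
proof -
  define d where "d = y \<bullet> (y - T y)"
  define p where "p = y \<bullet> (n - T n)"
  have p_eq: "p = (y - adjoint T y) \<bullet> n"
    by (simp add: p_def inner_diff_left inner_diff_right adjoint_works[OF lin] inner_commute)
  have d0: "0 \<le> d" using norm_residual_sq_le[of y] by (simp add: d_def) (smt (verit) zero_le_power2)
  have cross: "- 2 * p \<le> d / 2 + 4 * (norm n)\<^sup>2"
  proof -
    have "0 \<le> (norm ((1/2) *\<^sub>R (y - adjoint T y) + 2 *\<^sub>R n))\<^sup>2" by simp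
    also have "\<dots> = (1/4) * (norm (y - adjoint T y))\<^sup>2 + 2 * p + 4 * (norm n)\<^sup>2"
      unfolding p_eq power2_norm_eq_inner
      by (simp add: inner_add_left inner_add_right inner_commute)
    finally show ?thesis using norm_adjoint_residual_sq_le[of y] unfolding d_def by linarith
  qed
  have "(norm (y - \<gamma> *\<^sub>R (y - T y) - \<gamma> *\<^sub>R (n - T n)))\<^sup>2
      = (norm y)\<^sup>2 - 2 * \<gamma> * d - 2 * \<gamma> * p + \<gamma>\<^sup>2 * (norm ((y - T y) + (n - T n)))\<^sup>2"
    unfolding d_def p_def power2_norm_eq_inner
    by (simp add: inner_diff_left inner_diff_right inner_add_left inner_add_right inner_commute
        power2_eq_square algebra_simps)
  moreover have "\<gamma>\<^sup>2 * (norm ((y - T y) + (n - T n)))\<^sup>2 \<le> \<gamma> * (d / 100 + (norm n)\<^sup>2 / 50)"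
  proof -
    have "(norm (n - T n))\<^sup>2 \<le> (2 * norm n)\<^sup>2" by (intro power_mono norm_residual_le) auto
    then have "(norm ((y - T y) + (n - T n)))\<^sup>2 \<le> 4 * d + 8 * (norm n)\<^sup>2"
      using norm_add_sq_le[of 1 "y - T y" "n - T n"] norm_residual_sq_le[of y]
      by (simp add: d_def power_mult_distrib)
    then have "\<gamma> * (norm ((y - T y) + (n - T n)))\<^sup>2 \<le> (1 / 480) * (4 * d + 8 * (norm n)\<^sup>2)"
      using \<gamma> by (intro mult_mono) auto
    also have "\<dots> \<le> d / 100 + (norm n)\<^sup>2 / 50" using d0 zero_le_power2[of "norm n"] by (simp add: field_simps)
    finally show ?thesis using \<gamma> by (simp add: power2_eq_square mult.assoc)
  qed
  moreover have "\<gamma> * (- 2 * p) \<le> \<gamma> * (d / 2 + 4 * (norm n)\<^sup>2)"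
    using cross \<gamma> by (intro mult_left_mono) auto
  ultimately show ?thesis unfolding d_def[symmetric] by (simp add: algebra_simps)
qed

lemma perturbed_damped_step:
  assumes \<gamma>: "0 < \<gamma>" "\<gamma> \<le> 1 / 480"
  shows "(norm (y - \<gamma> *\<^sub>R (y - T y) - \<gamma> *\<^sub>R (n - T n) + h))\<^sup>2
    \<le> (norm y)\<^sup>2 - (99 / 100) * \<gamma> * (y \<bullet> (y - T y)) + (41 / 10) * \<gamma> * (norm n)\<^sup>2
       + (201 / 100) / (\<gamma> * (1 - \<sigma>)) * (norm h)\<^sup>2"
proof -
  define d where "d = y \<bullet> (y - T y)"
  define z where "z = y - \<gamma> *\<^sub>R (y - T y) - \<gamma> *\<^sub>R (n - T n)"
  \<comment> \<open>With this Young parameter the cost \<open>t * (norm y)\<^sup>2\<close> is at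
    most half of \<open>\<gamma> * d\<close>, leaving \<open>1.49 - 0.5 = 0.99\<close>. Its inverse
    gives the gain on \<open>h\<close>; the extra factor 1.005 absorbs the 1 in
    \<open>1 + inverse t\<close>.\<close>
  define t where "t = \<gamma> * (1 - \<sigma>) / 2"
  have t: "0 < t" "t \<le> 1/960"
  proof -
    show "0 < t" using \<gamma> \<sigma>_less_1 by (simp add: t_def)
    have "\<gamma> * (1 - \<sigma>) \<le> (1/480) * 1" using \<gamma> \<sigma>_less_1 \<sigma>_nonneg by (intro mult_mono) auto
    then show "t \<le> 1/960" by (simp add: t_def)
  qed
  have d0: "0 \<le> d" using norm_residual_sq_le[of y] by (simp add: d_def) (smt (verit) zero_le_power2)
  have z: "(norm z)\<^sup>2 \<le> (norm y)\<^sup>2 - (149 / 100) * \<gamma> * d + (402 / 100) * \<gamma> * (norm n)\<^sup>2"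
    using damped_step[OF \<gamma>] by (simp add: z_def d_def)
  have ty: "t * (norm y)\<^sup>2 \<le> \<gamma> * d / 2"
    using mult_left_mono[OF dissipation_ge[of y, folded d_def], of \<gamma>] \<gamma> by (simp add: t_def field_simps)
  have tn: "t * ((402 / 100) * \<gamma> * (norm n)\<^sup>2) \<le> (8 / 100) * \<gamma> * (norm n)\<^sup>2"
  proof -
    have "t * ((402 / 100) * \<gamma> * (norm n)\<^sup>2) \<le> (1/960) * ((402 / 100) * \<gamma> * (norm n)\<^sup>2)"
      using t \<gamma> by (intro mult_right_mono) auto
    also have "\<dots> \<le> (8 / 100) * \<gamma> * (norm n)\<^sup>2" using \<gamma> by (simp add: field_simps)
    finally show ?thesis .
  qed
  have "(1 + t) * (norm z)\<^sup>2 \<le> (1 + t) * ((norm y)\<^sup>2 - (149 / 100) * \<gamma> * d + (402 / 100) * \<gamma> * (norm n)\<^sup>2)"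
    using z t by (intro mult_left_mono) auto
  also have "\<dots> = (norm y)\<^sup>2 + t * (norm y)\<^sup>2 - (149 / 100) * \<gamma> * d - t * ((149 / 100) * \<gamma> * d)
      + (402 / 100) * \<gamma> * (norm n)\<^sup>2 + t * ((402 / 100) * \<gamma> * (norm n)\<^sup>2)"
    by (simp add: field_simps)
  also have "\<dots> \<le> (norm y)\<^sup>2 - (99 / 100) * \<gamma> * d + (41 / 10) * \<gamma> * (norm n)\<^sup>2"
  proof -
    have "0 \<le> t * ((149 / 100) * \<gamma> * d)" using t \<gamma> d0 by simp
    then show ?thesis using ty tn by (simp add: algebra_simps)
  qed
  finally have zz: "(1 + t) * (norm z)\<^sup>2 \<le> (norm y)\<^sup>2 - (99 / 100) * \<gamma> * d + (41 / 10) * \<gamma> * (norm n)\<^sup>2" .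
  have "1 + inverse t \<le> (201 / 100) / (\<gamma> * (1 - \<sigma>))"
  proof -
    have "1 + inverse t \<le> (1005 / 1000) * inverse t" using t by (simp add: field_simps)
    also have "\<dots> = (201 / 100) / (\<gamma> * (1 - \<sigma>))" using \<gamma> \<sigma>_less_1 by (simp add: t_def field_simps)
    finally show ?thesis .
  qed
  then have "(1 + inverse t) * (norm h)\<^sup>2 \<le> (201 / 100) / (\<gamma> * (1 - \<sigma>)) * (norm h)\<^sup>2"
    by (intro mult_right_mono) auto
  then show ?thesis using norm_add_sq_le[OF t(1), of z h] zz unfolding z_def d_def by linarith
qed

end

subsection \<open>Averaging and mixing\<close>

lemma linear_avg: "linear avg"
  by (rule linearI) (simp_all add: avg_def sum.distrib scaleR_add_right scaleR_sum_right mult.commute)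

lemma linear_rep_avg: "linear rep_avg"
  by (rule linearI) (simp_all add: rep_avg_def vec_eq_iff linear_add[OF linear_avg] linear_cmul[OF linear_avg])

lemma avg_rep_avg [simp]: "avg (rep_avg x) = avg x"
  by (simp add: avg_def rep_avg_def sum_constant_scaleR del: sum_constant)

lemma rep_avg_idem [simp]: "rep_avg (rep_avg x) = rep_avg x"
  by (simp add: rep_avg_def[of "rep_avg x"]) (simp add: rep_avg_def)

lemma inner_rep_avg: "x \<bullet> rep_avg y = real CARD('n) * (avg x \<bullet> avg y)"
  for x y :: "real ^ 'd ^ 'n"
  by (simp add: inner_vec_def[of x] rep_avg_def avg_def[of x] inner_sum_left[symmetric])

lemma norm_rep_avg_sq: "(norm (rep_avg x))\<^sup>2 = real CARD('n) * (norm (avg x))\<^sup>2"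
  for x :: "real ^ 'd ^ 'n"
  by (simp add: power2_norm_eq_inner inner_rep_avg)

lemma norm_sq_rep_avg_decomp: "(norm x)\<^sup>2 = (norm (x - rep_avg x))\<^sup>2 + (norm (rep_avg x))\<^sup>2"
proof -
  have "(x - rep_avg x) \<bullet> rep_avg x = 0"
    by (simp add: inner_rep_avg linear_diff[OF linear_avg])
  then show ?thesis
    using norm_add_Pythagorean[of "x - rep_avg x" "rep_avg x"] by (simp add: orthogonal_def)
qed

lemma norm_diff_rep_avg_le: "norm (x - rep_avg x) \<le> norm x"
proof (rule power2_le_imp_le)
  show "(norm (x - rep_avg x))\<^sup>2 \<le> (norm x)\<^sup>2"
    using norm_sq_rep_avg_decomp[of x] zero_le_power2[of "norm (rep_avg x)"] by linarith
qed simp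

definition mixing :: "real ^ 'n ^ 'n \<Rightarrow> real ^ 'd ^ 'n \<Rightarrow> real ^ 'd ^ 'n" where
  "mixing W x = (\<chi> i. \<Sum>j\<in>UNIV. (W $ i $ j) *\<^sub>R (x $ j))"

lemma mix_residual_eq: "mix_residual W x = x - mixing W x"
  by (simp add: mix_residual_def mixing_def vec_eq_iff)

lemma linear_mixing: "linear (mixing W)"
  by (rule linearI) (simp_all add: mixing_def vec_eq_iff scaleR_add_right sum.distrib sum_distrib_left mult_ac)

lemma linear_mix_residual: "linear (mix_residual W)"
  unfolding mix_residual_eq[abs_def] by (intro linear_compose_sub linear_mixing linear_ident)

lemma mixing_rep_avg:
  assumes "doubly_stochastic_weights E W"
  shows "mixing W (rep_avg x) = rep_avg x"
proof -
  have "(\<Sum>j\<in>UNIV. W $ i $ j) = 1" for i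
    using assms by (auto simp: doubly_stochastic_weights_def vec_eq_iff matrix_vector_mult_def)
  then show ?thesis
    by (simp add: mixing_def rep_avg_def flip: scaleR_sum_left)
qed

lemma avg_mixing:
  assumes "doubly_stochastic_weights E W"
  shows "avg (mixing W x) = avg x"
proof -
  have "(\<Sum>i\<in>UNIV. W $ i $ j) = 1" for j
    using assms by (auto simp: doubly_stochastic_weights_def vec_eq_iff vector_matrix_mult_def)
  then have "(\<Sum>i\<in>UNIV. \<Sum>j\<in>UNIV. (W $ i $ j) *\<^sub>R (x $ j)) = (\<Sum>j\<in>UNIV. x $ j)"
    by (subst sum.swap) (simp flip: scaleR_sum_left)
  then show ?thesis by (simp add: avg_def mixing_def)
qed

lemma avg_mix_residual:
  assumes "doubly_stochastic_weights E W"
  shows "avg (mix_residual W x) = 0"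
  by (simp add: mix_residual_eq linear_diff[OF linear_avg] avg_mixing[OF assms])

lemma rep_avg_mix_residual:
  assumes "doubly_stochastic_weights E W"
  shows "rep_avg (mix_residual W x) = 0"
  by (simp add: rep_avg_def avg_mix_residual[OF assms] vec_eq_iff)

text \<open>One and the same matrix acts on each scalar coordinate of the stacked vector separately,
  and the squared norms of the coordinates add up, so the spectral norm carries over.\<close>

lemma norm_mixing_diff_rep_avg:
  fixes W :: "real ^ 'n ^ 'n" and x :: "real ^ 'd ^ 'n"
  shows "norm (mixing W x - rep_avg x)
    \<le> spectral_norm (W - (\<chi> i j. 1 / real CARD('n))) * norm x"
proof -
  define A where "A = W - (\<chi> i j. 1 / real CARD('n))"
  define col where "col c = (\<chi> i. x $ i $ c)" for c
  have comp: "(mixing W x - rep_avg x) $ i $ c = (A *v col c) $ i" for i c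
    by (simp add: mixing_def rep_avg_def avg_def A_def col_def matrix_vector_mult_def
        sum_subtractf sum_distrib_left left_diff_distrib)
  have sq: "(norm y)\<^sup>2 = (\<Sum>c\<in>UNIV. (norm (\<chi> i. y $ i $ c))\<^sup>2)" for y :: "real ^ 'd ^ 'n"
    by (simp add: norm_vec_sq) (rule sum.swap)
  have bl: "bounded_linear (\<lambda>v. A *v v)" by (simp add: matrix_vector_mul_bounded_linear)
  have "(norm (mixing W x - rep_avg x))\<^sup>2 = (\<Sum>c\<in>UNIV. (norm (A *v col c))\<^sup>2)"
    unfolding sq comp by (simp add: norm_vec_sq)
  also have "\<dots> \<le> (\<Sum>c\<in>UNIV. (spectral_norm A * norm (col c))\<^sup>2)"
    unfolding spectral_norm_def by (intro sum_mono power_mono onorm[OF bl]) auto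
  also have "\<dots> = (spectral_norm A * norm x)\<^sup>2"
    by (simp add: power_mult_distrib sq[of x] sum_distrib_left col_def)
  finally show ?thesis
    unfolding A_def[symmetric]
    by (rule power2_le_imp_le) (simp add: spectral_norm_def onorm_pos_le[OF bl])
qed

lemma contraction_map_mixing:
  fixes W :: "real ^ 'n ^ 'n"
  assumes "\<sigma> = spectral_norm (W - (\<chi> i j. 1 / real CARD('n)))" "0 < \<sigma>" "\<sigma> < 1"
  shows "contraction_map (\<lambda>x :: real ^ 'd ^ 'n. mixing W x - rep_avg x) \<sigma>"
proof (rule contraction_map.intro)
  show "linear (\<lambda>x :: real ^ 'd ^ 'n. mixing W x - rep_avg x)"
    by (intro linear_compose_sub linear_mixing linear_rep_avg)
qed (use assms norm_mixing_diff_rep_avg[of W] in auto)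

text \<open>\<open>W\<close> fixes repeated averages, so the residual sees only the centred vector,
  whose own average vanishes. This is the form \<open>y - T y\<close> of
  \<open>contraction_map\<close>.\<close>

lemma mix_residual_perp:
  assumes "doubly_stochastic_weights E W"
  shows "mix_residual W x = (x - rep_avg x) - (mixing W (x - rep_avg x) - rep_avg (x - rep_avg x))"
  by (simp add: mix_residual_eq linear_diff[OF linear_mixing] linear_diff[OF linear_rep_avg]
      mixing_rep_avg[OF assms])

lemma mix_residual_bounds:
  fixes W :: "real ^ 'n ^ 'n" and x :: "real ^ 'd ^ 'n"
  assumes W: "doubly_stochastic_weights E W"
    and \<sigma>: "\<sigma> = spectral_norm (W - (\<chi> i j. 1 / real CARD('n)))" "0 < \<sigma>" "\<sigma> < 1"
  shows "(1 - \<sigma>) * (norm (x - rep_avg x))\<^sup>2 \<le> (x - rep_avg x) \<bullet> mix_residual W x"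
    and "(norm (mix_residual W x))\<^sup>2 \<le> 2 * ((x - rep_avg x) \<bullet> mix_residual W x)"
    and "norm (mix_residual W x) \<le> 2 * norm (x - rep_avg x)"
    and "norm (mix_residual W x) \<le> 2 * norm x"
proof -
  interpret contraction_map "\<lambda>x :: real ^ 'd ^ 'n. mixing W x - rep_avg x" \<sigma>
    by (rule contraction_map_mixing[OF \<sigma>])
  show "(1 - \<sigma>) * (norm (x - rep_avg x))\<^sup>2 \<le> (x - rep_avg x) \<bullet> mix_residual W x"
    "(norm (mix_residual W x))\<^sup>2 \<le> 2 * ((x - rep_avg x) \<bullet> mix_residual W x)"
    "norm (mix_residual W x) \<le> 2 * norm (x - rep_avg x)"
    unfolding mix_residual_perp[OF W, of x]
    by (rule dissipation_ge norm_residual_sq_le norm_residual_le)+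
  then show "norm (mix_residual W x) \<le> 2 * norm x"
    using norm_diff_rep_avg_le[of x] by linarith
qed

text \<open>Centring commutes with the step because residuals have average zero. Only the centred
  part of \<open>h\<close> remains; for \<open>X\<close> its average is the gradient step, treated
  by descent.\<close>

lemma consensus_step:
  fixes W :: "real ^ 'n ^ 'n" and x n h :: "real ^ 'd ^ 'n"
  assumes W: "doubly_stochastic_weights E W"
    and \<sigma>: "\<sigma> = spectral_norm (W - (\<chi> i j. 1 / real CARD('n)))" "0 < \<sigma>" "\<sigma> < 1"
    and \<gamma>: "0 < \<gamma>" "\<gamma> \<le> 1 / 480"
    and x': "x' = x - \<gamma> *\<^sub>R mix_residual W x - \<gamma> *\<^sub>R mix_residual W n + h"
  shows "(norm (x' - rep_avg x'))\<^sup>2 \<le> (norm (x - rep_avg x))\<^sup>2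
    - (99 / 100) * \<gamma> * ((x - rep_avg x) \<bullet> mix_residual W x) + (41 / 10) * \<gamma> * (norm n)\<^sup>2
    + (201 / 100) / (\<gamma> * (1 - \<sigma>)) * (norm (h - rep_avg h))\<^sup>2"
proof -
  interpret contraction_map "\<lambda>x :: real ^ 'd ^ 'n. mixing W x - rep_avg x" \<sigma>
    by (rule contraction_map_mixing[OF \<sigma>])
  have eq: "x' - rep_avg x' = (x - rep_avg x) - \<gamma> *\<^sub>R mix_residual W x - \<gamma> *\<^sub>R mix_residual W n
      + (h - rep_avg h)"
    by (simp add: x' linear_add[OF linear_rep_avg] linear_diff[OF linear_rep_avg]
        linear_cmul[OF linear_rep_avg] rep_avg_mix_residual[OF W])
  have "(norm (n - rep_avg n))\<^sup>2 \<le> (norm n)\<^sup>2"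
    by (intro power_mono norm_diff_rep_avg_le) auto
  then have "(41 / 10) * \<gamma> * (norm (n - rep_avg n))\<^sup>2 \<le> (41 / 10) * \<gamma> * (norm n)\<^sup>2"
    using \<gamma> by (intro mult_left_mono) auto
  then show ?thesis
    using perturbed_damped_step[OF \<gamma>, of "x - rep_avg x" "n - rep_avg n" "h - rep_avg h"]
    unfolding eq mix_residual_perp[OF W, of x] mix_residual_perp[OF W, of n] by linarith
qed

subsection \<open>Gradients and descent\<close>

lemma GDERIV_unique:
  fixes f :: "'a::euclidean_space \<Rightarrow> real"
  assumes "GDERIV f x :> u" "GDERIV f x :> v"
  shows "u = v"
proof -
  have "(\<lambda>h. h \<bullet> u) = (\<lambda>h. h \<bullet> v)"
    using assms unfolding gderiv_def by (rule has_derivative_unique)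
  from fun_cong[OF this, of "u - v"] have "(u - v) \<bullet> (u - v) = 0"
    by (simp add: inner_diff_right)
  then show ?thesis by simp
qed

lemma GDERIV_imp_grad:
  fixes f :: "'a::euclidean_space \<Rightarrow> real"
  assumes "GDERIV f x :> D"
  shows "grad f x = D"
  unfolding grad_def using assms by (blast intro: the_equality GDERIV_unique)

text \<open>Riesz representation: the gradient is the adjoint of the derivative, applied to
  1.\<close>

lemma GDERIV_grad:
  fixes f :: "'a::euclidean_space \<Rightarrow> real"
  assumes "f differentiable (at x)"
  shows "GDERIV f x :> grad f x"
proof -
  obtain D where D: "(f has_derivative D) (at x)" using assms by (auto simp: differentiable_def)
  have "linear D" using D by (rule has_derivative_linear)
  then have "D = (\<lambda>h. h \<bullet> adjoint D 1)" by (simp add: fun_eq_iff adjoint_works)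
  then have "GDERIV f x :> adjoint D 1" using D by (simp add: gderiv_def)
  then show ?thesis by (simp add: GDERIV_imp_grad)
qed

text \<open>The descent lemma: along the segment, \<open>f\<close> minus its quadratic model has
  nonpositive derivative.\<close>

lemma smooth_upper_bound:
  fixes f :: "'a::euclidean_space \<Rightarrow> real"
  assumes g: "\<And>x. GDERIV f x :> g x"
    and lip: "\<And>x y. norm (g x - g y) \<le> L * norm (x - y)"
  shows "f (x + v) \<le> f x + v \<bullet> g x + L / 2 * (norm v)\<^sup>2"
proof -
  define h where "h t = f (x + t *\<^sub>R v) - t * (v \<bullet> g x) - L / 2 * (norm v)\<^sup>2 * t\<^sup>2" for t
  have deriv: "(h has_real_derivative v \<bullet> g (x + t *\<^sub>R v) - v \<bullet> g x - L * (norm v)\<^sup>2 * t) (at t)" for t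
  proof -
    have "((\<lambda>t. f (x + t *\<^sub>R v)) has_derivative (\<lambda>s. (s *\<^sub>R v) \<bullet> g (x + t *\<^sub>R v))) (at t)"
      by (rule has_derivative_compose[of "\<lambda>t. x + t *\<^sub>R v" "\<lambda>s. s *\<^sub>R v" t UNIV f])
        (auto intro!: derivative_eq_intros simp: g[unfolded gderiv_def])
    then have "((\<lambda>t. f (x + t *\<^sub>R v)) has_real_derivative v \<bullet> g (x + t *\<^sub>R v)) (at t)"
      by (simp add: has_field_derivative_def mult_commute_abs)
    then show ?thesis unfolding h_def[abs_def]
      by (auto intro!: derivative_eq_intros)
  qed
  have "h 1 \<le> h 0"
  proof (rule DERIV_nonpos_imp_nonincreasing[of 0 1])
    fix t :: real assume t: "0 \<le> t" "t \<le> 1"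
    have "v \<bullet> g (x + t *\<^sub>R v) - v \<bullet> g x = v \<bullet> (g (x + t *\<^sub>R v) - g x)"
      by (simp add: inner_diff_right)
    also have "\<dots> \<le> norm v * norm (g (x + t *\<^sub>R v) - g x)" by (rule norm_cauchy_schwarz)
    also have "\<dots> \<le> norm v * (L * norm (t *\<^sub>R v))"
      using lip[of "x + t *\<^sub>R v" x] by (intro mult_left_mono) auto
    also have "\<dots> = L * (norm v)\<^sup>2 * t" using t by (simp add: power2_eq_square)
    finally show "\<exists>y. (h has_real_derivative y) (at t) \<and> y \<le> 0"
      using deriv[of t] by auto
  qed simp
  then show ?thesis by (simp add: h_def)
qed

lemma GDERIV_mean_cost:
  fixes F :: "'n::finite \<Rightarrow> 'a::euclidean_space \<Rightarrow> real"
  assumes "\<And>i. F i differentiable (at x)"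
  shows "GDERIV (mean_cost F) x :> (1 / real CARD('n)) *\<^sub>R (\<Sum>i\<in>UNIV. grad (F i) x)"
proof -
  have "((\<lambda>x. (1 / real CARD('n)) * (\<Sum>i\<in>UNIV. F i x)) has_derivative
      (\<lambda>h. (1 / real CARD('n)) * (\<Sum>i\<in>UNIV. h \<bullet> grad (F i) x))) (at x)"
    using GDERIV_grad[OF assms] unfolding gderiv_def
    by (intro has_derivative_mult_right has_derivative_sum) auto
  then show ?thesis
    by (simp add: gderiv_def mean_cost_def[abs_def] inner_sum_right)
qed

lemma min_value_le:
  assumes "argmin f \<noteq> {}"
  shows "min_value f \<le> f x"
proof -
  obtain z where "\<And>y. f z \<le> f y" using assms by (auto simp: argmin_def)
  then have "bdd_below (range f)" by (intro bdd_belowI[of _ "f z"]) auto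
  then show ?thesis by (simp add: min_value_def cINF_lower)
qed

lemma norm_stacked_grad_diff_le:
  assumes "0 \<le> L" and "\<And>i x y. norm (grad (F i) x - grad (F i) y) \<le> L * norm (x - y)"
  shows "norm (stacked_grad F x - stacked_grad F y) \<le> L * norm (x - y)"
proof (rule power2_le_imp_le)
  have "(norm (stacked_grad F x - stacked_grad F y))\<^sup>2
      = (\<Sum>i\<in>UNIV. (norm (grad (F i) (x $ i) - grad (F i) (y $ i)))\<^sup>2)"
    by (simp add: norm_vec_sq stacked_grad_def)
  also have "\<dots> \<le> (\<Sum>i\<in>UNIV. (L * norm (x $ i - y $ i))\<^sup>2)"
    using assms by (intro sum_mono power_mono) auto
  also have "\<dots> = (L * norm (x - y))\<^sup>2"
    by (simp add: power_mult_distrib norm_vec_sq[of "x - y"] sum_distrib_left)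
  finally show "(norm (stacked_grad F x - stacked_grad F y))\<^sup>2 \<le> (L * norm (x - y))\<^sup>2" .
qed (use assms in auto)

lemma optimality_gap_nonneg:
  assumes "argmin (mean_cost F) \<noteq> {}"
  shows "0 \<le> optimality_gap F x"
  using min_value_le[OF assms] by (simp add: optimality_gap_def)

text \<open>Descent at the average with the inexact gradient \<open>y\<close>, the mean of the local
  gradients, instead of the true gradient \<open>p\<close>. Polarizing \<open>y \<bullet> p\<close>
  yields the square of \<open>p\<close> for the Polyak-Lojasiewicz condition, an error
  \<open>p - y\<close> controlled by the consensus error, and the square of \<open>y\<close>. Half
  of the latter pays for the smoothness term; the other half is kept in the conclusion to absorb the
  mean gradient inside the displacement.\<close>

lemma optimality_gap_step:
  fixes F :: "'n::finite \<Rightarrow> real ^ 'd \<Rightarrow> real" and x x' :: "real ^ 'd ^ 'n"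
  assumes diff: "\<And>i x. F i differentiable (at x)"
    and L: "0 < L" "\<And>i x y. norm (grad (F i) x - grad (F i) y) \<le> L * norm (x - y)"
    and PL: "PL_condition (mean_cost F) \<nu>"
    and \<eta>: "0 < \<eta>" "\<eta> \<le> 1 / (2 * L)"
    and x': "avg x' = avg x - \<eta> *\<^sub>R avg (stacked_grad F x)"
  shows "optimality_gap F x' \<le> (1 - \<nu> * \<eta>) * optimality_gap F x
    - \<eta> / 4 * (norm (rep_avg (stacked_grad F x)))\<^sup>2
    + \<eta> / 2 * L\<^sup>2 * (norm (x - rep_avg x))\<^sup>2"
proof -
  define N where "N = real CARD('n)"
  define f where "f = mean_cost F"
  define g where "g z = (1 / N) *\<^sub>R (\<Sum>i\<in>UNIV. grad (F i) z)" for z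
  define p where "p = g (avg x)"
  define y where "y = avg (stacked_grad F x)"
  have N: "0 < N" by (simp add: N_def)
  have gder: "GDERIV f z :> g z" for z
    using GDERIV_mean_cost[OF diff] by (simp add: f_def g_def[abs_def] N_def)
  have g_rep: "g z = avg (stacked_grad F (\<chi> i. z))" for z
    by (simp add: g_def avg_def stacked_grad_def N_def)
  \<comment> \<open>Both Lipschitz estimates below are reduced by this to the stacked gradient,
    evaluated at repeated vectors.\<close>
  have avg_sq: "N * (norm (avg u))\<^sup>2 \<le> (norm u)\<^sup>2" for u :: "real ^ 'd ^ 'n"
    using norm_sq_rep_avg_decomp[of u] norm_rep_avg_sq[of u] by (simp add: N_def)
  have g_lip: "norm (g a - g b) \<le> L * norm (a - b)" for a b
  proof (rule power2_le_imp_le)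
    have "N * (norm (g a - g b))\<^sup>2 \<le> (norm (stacked_grad F (\<chi> i. a) - stacked_grad F (\<chi> i. b)))\<^sup>2"
      using avg_sq[of "stacked_grad F (\<chi> i. a) - stacked_grad F (\<chi> i. b)"]
      by (simp add: g_rep linear_diff[OF linear_avg])
    also have "\<dots> \<le> (L * norm ((\<chi> i. a) - (\<chi> i. b) :: real ^ 'd ^ 'n))\<^sup>2"
      using L by (intro power_mono norm_stacked_grad_diff_le) auto
    also have "\<dots> = N * (L * norm (a - b))\<^sup>2"
      by (simp add: power_mult_distrib norm_vec_sq N_def)
    finally show "(norm (g a - g b))\<^sup>2 \<le> (L * norm (a - b))\<^sup>2" using N by simp
  qed (use L in auto)
  have py: "N * (norm (p - y))\<^sup>2 \<le> L\<^sup>2 * (norm (x - rep_avg x))\<^sup>2"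
  proof -
    have "N * (norm (p - y))\<^sup>2 \<le> (norm (stacked_grad F (rep_avg x) - stacked_grad F x))\<^sup>2"
      using avg_sq[of "stacked_grad F (rep_avg x) - stacked_grad F x"]
      by (simp add: p_def y_def g_rep linear_diff[OF linear_avg] rep_avg_def)
    also have "\<dots> \<le> (L * norm (rep_avg x - x))\<^sup>2"
      using L by (intro power_mono norm_stacked_grad_diff_le) auto
    finally show ?thesis by (simp add: power_mult_distrib norm_minus_commute)
  qed
  have "f (avg x') \<le> f (avg x) - \<eta> * (y \<bullet> p) + L / 2 * (\<eta>\<^sup>2 * (norm y)\<^sup>2)"
    using smooth_upper_bound[OF gder g_lip, of "avg x" "- \<eta> *\<^sub>R y"]
    by (simp add: x' y_def[symmetric] p_def power_mult_distrib)
  also have "L / 2 * (\<eta>\<^sup>2 * (norm y)\<^sup>2) \<le> \<eta> / 4 * (norm y)\<^sup>2"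
  proof -
    have "L * \<eta> \<le> 1 / 2" using \<eta> L by (simp add: field_simps)
    then have "(L * \<eta>) * (\<eta> / 2 * (norm y)\<^sup>2) \<le> (1 / 2) * (\<eta> / 2 * (norm y)\<^sup>2)"
      using \<eta> by (intro mult_right_mono) auto
    then show ?thesis by (simp add: power2_eq_square algebra_simps)
  qed
  also have "\<eta> * (y \<bullet> p) = \<eta> / 2 * ((norm p)\<^sup>2 + (norm y)\<^sup>2 - (norm (p - y))\<^sup>2)"
    by (simp add: power2_norm_eq_inner inner_diff_left inner_diff_right inner_commute algebra_simps)
  finally have step: "f (avg x') \<le> f (avg x) - \<eta> * ((1 / 2) * (norm p)\<^sup>2) - \<eta> / 4 * (norm y)\<^sup>2
      + \<eta> / 2 * (norm (p - y))\<^sup>2"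
    by (simp add: algebra_simps)
  have "\<eta> * (\<nu> * (f (avg x) - min_value f)) \<le> \<eta> * ((1 / 2) * (norm p)\<^sup>2)"
    using PL \<eta> by (intro mult_left_mono)
      (auto simp: PL_condition_def f_def[symmetric] p_def GDERIV_imp_grad[OF gder])
  with step have "f (avg x') - min_value f \<le> (1 - \<nu> * \<eta>) * (f (avg x) - min_value f)
      - \<eta> / 4 * (norm y)\<^sup>2 + \<eta> / 2 * (norm (p - y))\<^sup>2"
    by (simp add: algebra_simps)
  then have "N * (f (avg x') - min_value f) \<le> N * ((1 - \<nu> * \<eta>) * (f (avg x) - min_value f)
      - \<eta> / 4 * (norm y)\<^sup>2 + \<eta> / 2 * (norm (p - y))\<^sup>2)"
    using N by (intro mult_left_mono) auto
  also have "\<dots> = (1 - \<nu> * \<eta>) * (N * (f (avg x) - min_value f))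
      - \<eta> / 4 * (N * (norm y)\<^sup>2) + \<eta> / 2 * (N * (norm (p - y))\<^sup>2)"
    by (simp add: algebra_simps)
  also have "\<eta> / 2 * (N * (norm (p - y))\<^sup>2) \<le> \<eta> / 2 * (L\<^sup>2 * (norm (x - rep_avg x))\<^sup>2)"
    using py \<eta> by (intro mult_left_mono) auto
  finally show ?thesis
    by (simp add: optimality_gap_def f_def N_def y_def norm_rep_avg_sq mult.assoc)
qed

subsection \<open>One step of the Lyapunov function\<close>

text \<open>The noise is split into \<open>r\<close> times the rescaled error, which the contraction
  property controls, and the bias \<open>(r - 1) *\<^sub>R e\<close>. In expectation they give the
  two summands of the constant \<open>C\<close>.\<close>

lemma compression_noise_sq_le:
  fixes q e :: "'a::real_inner"
  assumes "0 < r"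
  shows "(norm (q - e))\<^sup>2 \<le> 2 * r\<^sup>2 * (norm (q /\<^sub>R r - e))\<^sup>2 + 2 * (1 - r)\<^sup>2 * (norm e)\<^sup>2"
proof -
  have "q - e = r *\<^sub>R (q /\<^sub>R r - e) + (r - 1) *\<^sub>R e"
    using assms by (simp add: algebra_simps)
  then show ?thesis
    using norm_add_sq_le[of 1 "r *\<^sub>R (q /\<^sub>R r - e)" "(r - 1) *\<^sub>R e"]
    by (simp add: power_mult_distrib power2_commute[of r 1])
qed

text \<open>The update is a convex combination of \<open>e\<close> and \<open>- u\<close> with
  weight \<open>t = \<phi> * r < 1\<close>, so convexity of the square applies. In expectation the
  factor becomes \<open>1 - \<phi> * r * \<psi>\<close>, which is the origin of
  \<open>c\<^sub>1\<close> and \<open>c\<^sub>2\<close>: it is \<open>1 - 2 * c\<close> for either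
  of them.\<close>

lemma compressed_update_sq_le:
  fixes q e :: "'a::real_inner"
  assumes "0 < r" "0 < \<phi>" "\<phi> < 1 / r"
  shows "(norm (e - \<phi> *\<^sub>R q))\<^sup>2 \<le> (1 - \<phi> * r) * (norm e)\<^sup>2 + \<phi> * r * (norm (q /\<^sub>R r - e))\<^sup>2"
proof -
  define t where "t = \<phi> * r"
  define u where "u = q /\<^sub>R r - e"
  have t: "0 < t" "t < 1" using assms by (auto simp: t_def field_simps)
  have "e - \<phi> *\<^sub>R q = (1 - t) *\<^sub>R e - t *\<^sub>R u"
    using assms by (simp add: t_def u_def algebra_simps)
  then have "norm (e - \<phi> *\<^sub>R q) \<le> (1 - t) * norm e + t * norm u"
    using norm_triangle_ineq4[of "(1 - t) *\<^sub>R e" "t *\<^sub>R u"] t by simp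
  then have "(norm (e - \<phi> *\<^sub>R q))\<^sup>2 \<le> ((1 - t) * norm e + t * norm u)\<^sup>2"
    by (intro power_mono) auto
  also have "\<dots> = (1 - t) * (norm e)\<^sup>2 + t * (norm u)\<^sup>2 - t * (1 - t) * (norm e - norm u)\<^sup>2"
    by (simp add: power2_eq_square algebra_simps)
  also have "\<dots> \<le> (1 - t) * (norm e)\<^sup>2 + t * (norm u)\<^sup>2" using t by simp
  finally show ?thesis by (simp add: t_def u_def)
qed

text \<open>Pure real arithmetic, separated from the vectors. \<open>s\<close> is
  \<open>1 - \<sigma>\<close>; \<open>a\<close>, \<open>b\<close> are the squared consensus errors
  of \<open>X\<close>, \<open>Y\<close>; \<open>e\<close>, \<open>f\<close> the squared compression
  errors; \<open>g\<close> the squared norm of the repeated average of \<open>Y\<close>;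
  \<open>G\<close> the optimality gap; \<open>d\<close> the dissipation of \<open>Y\<close>;
  \<open>D\<close> the squared displacement of \<open>X\<close>; \<open>N\<close> the squared noise;
  \<open>w\<close> the excess of the compression error over its contraction bound. Primes mark the
  next time. Once \<open>D\<close> and \<open>N\<close> are eliminated, the bound is linear in the
  remaining quantities and is compared coefficient by coefficient.\<close>

lemma lyapunov_step_arithmetic:
  fixes s L \<gamma> \<eta> \<nu> \<phi> \<theta> c\<^sub>1 c\<^sub>2 C R p\<^sub>X p\<^sub>Y a b d e f g G D N\<^sub>X N\<^sub>Y w\<^sub>X w\<^sub>Y a' b' e' f' G' :: real
  assumes s: "0 < s" "s \<le> 1" and L: "0 < L" and C: "0 \<le> C"
    and c: "0 < c\<^sub>1" "0 < c\<^sub>2" "c\<^sub>2 \<le> 1 / 2"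
    and \<gamma>: "0 < \<gamma>" "\<gamma> * (1 + inverse c\<^sub>1) \<le> s / 160" "\<gamma> * (1 + inverse c\<^sub>2) * L\<^sup>2 \<le> s / 40000"
      "\<gamma> * C \<le> c\<^sub>1 * s / 40" "\<gamma> * C \<le> c\<^sub>2 * L\<^sup>2" "\<gamma>\<^sup>2 * C \<le> c\<^sub>2\<^sup>2 / 100"
    and \<eta>: "0 < \<eta>" "\<eta> * L \<le> s\<^sup>2 * \<gamma> / 40" "\<eta> * L\<^sup>2 \<le> (4 / 10) * s * \<gamma>" "\<eta> \<le> \<gamma>"
    and \<phi>: "\<phi> = s\<^sup>2 / (320 * L\<^sup>2)"
    and \<theta>: "\<theta> \<le> (7 / 100) * s * \<gamma>" "\<theta> \<le> (44 / 100) * c\<^sub>1 * (2 * c\<^sub>1 + 1)" "\<theta> \<le> (77 / 100) * c\<^sub>2 * (2 * c\<^sub>2 + 1)" "\<theta> \<le> \<nu> * \<eta>"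
    and K: "K = \<phi> * ((201 / 100) / (\<gamma> * s) * L\<^sup>2) + (1 + inverse c\<^sub>1) + s * (3 * (1 + inverse c\<^sub>2) * L\<^sup>2)"
    and nonneg: "0 \<le> a" "0 \<le> b" "0 \<le> e" "0 \<le> f" "0 \<le> g" "0 \<le> G"
    and d: "s * b \<le> d"
    and N: "N\<^sub>X \<le> C * e + R * w\<^sub>X" "N\<^sub>Y \<le> C * f + R * w\<^sub>Y"
    and D: "D \<le> 4 * (4 * \<gamma>\<^sup>2 * a + 4 * \<gamma>\<^sup>2 * N\<^sub>X + \<eta>\<^sup>2 * b + \<eta>\<^sup>2 * g)"
    and a': "a' \<le> a - (99 / 100) * \<gamma> * (s * a) + (41 / 10) * \<gamma> * N\<^sub>X + (201 / 100) / (\<gamma> * s) * (\<eta>\<^sup>2 * b)"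
    and b': "b' \<le> b - (99 / 100) * \<gamma> * d + (41 / 10) * \<gamma> * N\<^sub>Y + (201 / 100) / (\<gamma> * s) * (L\<^sup>2 * D)"
    and e': "e' \<le> (1 + c\<^sub>1) * ((1 - 2 * c\<^sub>1) * e + p\<^sub>X * w\<^sub>X) + (1 + inverse c\<^sub>1) * D"
    and f': "f' \<le> (1 + c\<^sub>2) * ((1 - 2 * c\<^sub>2) * f + p\<^sub>Y * w\<^sub>Y)
      + (1 + inverse c\<^sub>2) * (3 * (2 * \<gamma>\<^sup>2 * d + 4 * \<gamma>\<^sup>2 * N\<^sub>Y + L\<^sup>2 * D))"
    and G': "G' \<le> (1 - \<nu> * \<eta>) * G - \<eta> / 4 * g + \<eta> / 2 * L\<^sup>2 * a"
  shows "a' + \<phi> * b' + e' + s * f' + G' \<le> (1 - \<theta>) * (a + \<phi> * b + e + s * f + G)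
    + (((41 / 10) * \<gamma> + 16 * \<gamma>\<^sup>2 * K) * R + (1 + c\<^sub>1) * p\<^sub>X) * w\<^sub>X
    + (((41 / 10) * \<gamma> * \<phi> + 12 * s * (1 + inverse c\<^sub>2) * \<gamma>\<^sup>2) * R + s * (1 + c\<^sub>2) * p\<^sub>Y) * w\<^sub>Y"
proof -
  define i\<^sub>1 i\<^sub>2 where i_def: "i\<^sub>1 = 1 + inverse c\<^sub>1" "i\<^sub>2 = 1 + inverse c\<^sub>2"
  define u where "u = (201 / 100) / (\<gamma> * s)"
  define M\<^sub>X M\<^sub>Y where M_def: "M\<^sub>X = (41 / 10) * \<gamma> + 16 * \<gamma>\<^sup>2 * K" "M\<^sub>Y = (41 / 10) * \<gamma> * \<phi> + 12 * s * i\<^sub>2 * \<gamma>\<^sup>2"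
  have i_pos: "0 < i\<^sub>1" "0 < i\<^sub>2" using c by (simp_all add: i_def add_pos_pos)
  have \<phi>_pos: "0 < \<phi>" using s L by (simp add: \<phi>)
  have \<phi>L: "\<phi> * L\<^sup>2 = s\<^sup>2 / 320" using L by (simp add: \<phi>)
  have u_pos: "0 < u" using s \<gamma> by (simp add: u_def)
  have K_eq: "K = \<phi> * (u * L\<^sup>2) + i\<^sub>1 + s * (3 * i\<^sub>2 * L\<^sup>2)" by (simp add: K u_def i_def)
  have K_pos: "0 < K" unfolding K_eq using \<phi>_pos u_pos i_pos s L by (intro add_pos_pos mult_pos_pos) auto
  have M_pos: "0 < M\<^sub>X" "0 < M\<^sub>Y"
    unfolding M_def using K_pos \<gamma> \<phi>_pos i_pos s by (intro add_pos_pos mult_pos_pos; simp)+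
  have s2: "s\<^sup>2 \<le> s" using s by (simp add: power2_eq_square mult_left_le)
  \<comment> \<open>The three summands of \<open>K\<close> contribute at most
    \<open>2.01 / 320\<close>, \<open>1 / 160\<close> and \<open>3 / 40000\<close> times
    \<open>s\<close>.\<close>
  have \<gamma>K: "\<gamma> * K \<le> (127 / 10000) * s"
  proof -
    have "\<gamma> * (\<phi> * (u * L\<^sup>2)) = (\<phi> * L\<^sup>2) * (\<gamma> * u)" by (simp only: mult_ac)
    also have "\<dots> = (201 / 100) * s / 320" using s \<gamma>(1) unfolding \<phi>L u_def by (simp add: power2_eq_square)
    finally have 1: "\<gamma> * (\<phi> * (u * L\<^sup>2)) = (201 / 100) * s / 320" .
    have "\<gamma> * (s * (3 * i\<^sub>2 * L\<^sup>2)) = 3 * s * (\<gamma> * i\<^sub>2 * L\<^sup>2)" by (simp only: mult_ac)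
    also have "\<dots> \<le> 3 * s * (s / 40000)" using \<gamma> s by (intro mult_left_mono) (auto simp: i_def)
    also have "\<dots> \<le> 3 * s / 40000" using s2 by (simp add: power2_eq_square)
    finally have 2: "\<gamma> * (s * (3 * i\<^sub>2 * L\<^sup>2)) \<le> 3 * s / 40000" .
    have 3: "\<gamma> * i\<^sub>1 \<le> s / 160" using \<gamma>(2) by (simp only: i_def)
    have "\<gamma> * K = \<gamma> * (\<phi> * (u * L\<^sup>2)) + \<gamma> * i\<^sub>1 + \<gamma> * (s * (3 * i\<^sub>2 * L\<^sup>2))"
      unfolding K_eq by (simp only: distrib_left)
    then show ?thesis using 1 2 3 s(1) by linarith
  qed
  have \<gamma>2K: "16 * \<gamma>\<^sup>2 * K \<le> (2032 / 10000) * (s * \<gamma>)"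
    using mult_left_mono[OF \<gamma>K, of "16 * \<gamma>"] \<gamma> by (simp add: power2_eq_square algebra_simps)
  \<comment> \<open>The constant is \<open>320 / 40\<^sup>2\<close>: square the bound on
    \<open>\<eta> * L\<close> and trade \<open>s\<^sup>2 / 320\<close> for
    \<open>\<phi> * L\<^sup>2\<close>.\<close>
  have \<eta>2: "\<eta>\<^sup>2 \<le> (2 / 10) * s\<^sup>2 * \<gamma>\<^sup>2 * \<phi>"
  proof -
    have "(\<eta> * L)\<^sup>2 \<le> (s\<^sup>2 * \<gamma> / 40)\<^sup>2" using \<eta> L by (intro power_mono) auto
    also have "\<dots> = ((2 / 10) * s\<^sup>2 * \<gamma>\<^sup>2 * \<phi>) * L\<^sup>2"
      using \<phi>L by (simp add: power_mult_distrib power_divide power2_eq_square mult.assoc)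
    finally show ?thesis using L by (simp add: power_mult_distrib)
  qed

  \<comment> \<open>In units of \<open>s * \<gamma>\<close>: damping 0.99, less 0.2 for the descent
    error and 0.2032 for the displacement, against a rate of 0.07.\<close>
  have ca: "1 - (99 / 100) * \<gamma> * s + \<eta> / 2 * L\<^sup>2 + 16 * \<gamma>\<^sup>2 * K \<le> 1 - \<theta>"
    using \<gamma>2K \<eta>(3) \<theta>(1) mult_pos_pos[OF s(1) \<gamma>(1)] by (simp add: algebra_simps)
  \<comment> \<open>\<open>6 * 320 / 40000 = 0.048\<close>: the factor 40000 in the step size bound
    makes the drift of the compression error of \<open>Y\<close> a small share of the
    dissipation.\<close>
  have cd: "6 * s * i\<^sub>2 * \<gamma>\<^sup>2 \<le> (48 / 1000) * (\<gamma> * \<phi>)"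
  proof -
    have "(6 * s * \<gamma>) * (\<gamma> * i\<^sub>2 * L\<^sup>2) \<le> (6 * s * \<gamma>) * (s / 40000)"
      using \<gamma> s by (intro mult_left_mono) (auto simp: i_def)
    also have "\<dots> = ((48 / 1000) * (\<gamma> * \<phi>)) * L\<^sup>2" using \<phi>L by (simp add: power2_eq_square mult_ac)
    finally have "(6 * s * i\<^sub>2 * \<gamma>\<^sup>2) * L\<^sup>2 \<le> ((48 / 1000) * (\<gamma> * \<phi>)) * L\<^sup>2"
      by (simp add: power2_eq_square mult_ac)
    then show ?thesis using L by simp
  qed
  \<comment> \<open>In units of \<open>\<gamma> * \<phi> * s\<close>: damping 0.94, less 0.402 for
    driving \<open>X\<close> and 0.011 for the displacement, against 0.07.\<close>
  have cb: "\<phi> + u * \<eta>\<^sup>2 + 4 * K * \<eta>\<^sup>2 - (94 / 100) * (\<gamma> * \<phi>) * s \<le> (1 - \<theta>) * \<phi>"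
  proof -
    have "u * \<eta>\<^sup>2 \<le> u * ((2 / 10) * s\<^sup>2 * \<gamma>\<^sup>2 * \<phi>)" using \<eta>2 u_pos by (intro mult_left_mono) auto
    also have "\<dots> = (402 / 1000) * (\<gamma> * \<phi> * s)" using s \<gamma> by (simp add: u_def power2_eq_square)
    finally have 1: "u * \<eta>\<^sup>2 \<le> (402 / 1000) * (\<gamma> * \<phi> * s)" .
    have "4 * K * \<eta>\<^sup>2 \<le> 4 * K * ((2 / 10) * s\<^sup>2 * \<gamma>\<^sup>2 * \<phi>)" using \<eta>2 K_pos by (intro mult_left_mono) auto
    also have "\<dots> = ((8 / 10) * s\<^sup>2 * \<gamma> * \<phi>) * (\<gamma> * K)" by (simp add: power2_eq_square)
    also have "\<dots> \<le> ((8 / 10) * s * \<gamma> * \<phi>) * (127 / 10000)"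
      using s s2 \<gamma>K \<gamma> \<phi>_pos K_pos by (intro mult_mono) (auto simp: mult_le_cancel_right)
    finally have 2: "4 * K * \<eta>\<^sup>2 \<le> (11 / 1000) * (\<gamma> * \<phi> * s)"
      using mult_pos_pos[OF mult_pos_pos[OF \<gamma>(1) \<phi>_pos] s(1)] by (simp add: mult_ac)
    have "\<theta> * \<phi> \<le> (7 / 100) * (\<gamma> * \<phi> * s)"
      using mult_right_mono[OF \<theta>(1), of \<phi>] \<phi>_pos by (simp add: mult_ac)
    then show ?thesis using 1 2 mult_pos_pos[OF mult_pos_pos[OF \<gamma>(1) \<phi>_pos] s(1)]
      by (simp add: left_diff_distrib)
  qed
  \<comment> \<open>The product is \<open>1 - (c\<^sub>1 + 2 * c\<^sub>1\<^sup>2)\<close>, and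
    \<open>\<theta>\<close> takes at most 0.44 of the bracket; the noise needs only
    \<open>0.11 * c\<^sub>1\<close>.\<close>
  have ce: "(1 + c\<^sub>1) * (1 - 2 * c\<^sub>1) + M\<^sub>X * C \<le> 1 - \<theta>"
  proof -
    have \<gamma>C: "\<gamma> * C \<le> c\<^sub>1 / 40" using \<gamma>(4) mult_left_le[OF s(2), of c\<^sub>1] c by linarith
    have "16 * \<gamma>\<^sup>2 * K * C = 16 * ((\<gamma> * K) * (\<gamma> * C))" by (simp add: power2_eq_square)
    also have "\<dots> \<le> 16 * ((127 / 10000) * (c\<^sub>1 / 40))"
      using \<gamma>K \<gamma>C s C \<gamma> K_pos by (intro mult_left_mono mult_mono) auto
    finally have "16 * \<gamma>\<^sup>2 * K * C \<le> 16 * ((127 / 10000) * (c\<^sub>1 / 40))" .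
    moreover have "M\<^sub>X * C = (41 / 10) * (\<gamma> * C) + 16 * \<gamma>\<^sup>2 * K * C"
      unfolding M_def by (simp only: distrib_right mult.assoc)
    ultimately have "M\<^sub>X * C \<le> (11 / 100) * c\<^sub>1" using \<gamma>C c(1) by linarith
    moreover have "0 < c\<^sub>1 * c\<^sub>1" using c by simp
    moreover have "(1 + c\<^sub>1) * (1 - 2 * c\<^sub>1) = 1 - c\<^sub>1 - 2 * (c\<^sub>1 * c\<^sub>1)"
      by (simp add: algebra_simps)
    moreover have "(44 / 100) * c\<^sub>1 * (2 * c\<^sub>1 + 1) = (88 / 100) * (c\<^sub>1 * c\<^sub>1) + (44 / 100) * c\<^sub>1"
      by (simp add: field_simps)
    ultimately show ?thesis using \<theta>(2) c(1) by linarith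
  qed
  \<comment> \<open>The tight coefficient: the noise takes \<open>4.1 / 320 + 12 * 0.015\<close>,
    rounded up to 0.2, so 0.8 of \<open>c\<^sub>2\<close> remains for the 0.77 in the bound on
    \<open>\<theta>\<close>.\<close>
  have cf: "s * (1 + c\<^sub>2) * (1 - 2 * c\<^sub>2) + M\<^sub>Y * C \<le> (1 - \<theta>) * s"
  proof -
    have "\<phi> * (\<gamma> * C) \<le> \<phi> * (c\<^sub>2 * L\<^sup>2)" using \<gamma> \<phi>_pos by (intro mult_left_mono) auto
    also have "\<dots> = c\<^sub>2 * s\<^sup>2 / 320" using \<phi>L by (simp add: mult_ac)
    also have "\<dots> \<le> c\<^sub>2 * s / 320" using c s2 by simp
    finally have 1: "\<phi> * (\<gamma> * C) \<le> c\<^sub>2 * s / 320" .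
    \<comment> \<open>The square of \<open>c\<^sub>2\<close> compensates the inverse of
      \<open>c\<^sub>2\<close> in \<open>i\<^sub>2\<close> and leaves one factor
      \<open>c\<^sub>2\<close> to compare with the damping.\<close>
    have "i\<^sub>2 * (\<gamma>\<^sup>2 * C) \<le> i\<^sub>2 * (c\<^sub>2\<^sup>2 / 100)" using \<gamma> i_pos by (intro mult_left_mono) auto
    also have "\<dots> = (c\<^sub>2 + c\<^sub>2 * c\<^sub>2) / 100" using c by (simp add: i_def power2_eq_square field_simps)
    also have "\<dots> \<le> (15 / 1000) * c\<^sub>2" using c mult_left_mono[OF c(3), of c\<^sub>2] by simp
    finally have 2: "s * (i\<^sub>2 * (\<gamma>\<^sup>2 * C)) \<le> s * ((15 / 1000) * c\<^sub>2)" using s by (intro mult_left_mono) auto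
    have "M\<^sub>Y * C = (41 / 10) * (\<phi> * (\<gamma> * C)) + 12 * (s * (i\<^sub>2 * (\<gamma>\<^sup>2 * C)))"
      by (simp add: M_def algebra_simps)
    also have "\<dots> \<le> (2 / 10) * (s * c\<^sub>2)" using 1 2 mult_pos_pos[OF s(1) c(2)] by (simp add: mult_ac)
    finally have "M\<^sub>Y * C \<le> s * ((2 / 10) * c\<^sub>2)" by simp
    moreover have "(1 + c\<^sub>2) * (1 - 2 * c\<^sub>2) + (2 / 10) * c\<^sub>2 \<le> 1 - \<theta>"
    proof -
      have "(1 + c\<^sub>2) * (1 - 2 * c\<^sub>2) = 1 - c\<^sub>2 - 2 * (c\<^sub>2 * c\<^sub>2)"
        by (simp add: algebra_simps)
      moreover have "(77 / 100) * c\<^sub>2 * (2 * c\<^sub>2 + 1) = (154 / 100) * (c\<^sub>2 * c\<^sub>2) + (77 / 100) * c\<^sub>2"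
        by (simp add: field_simps)
      ultimately show ?thesis using \<theta>(3) c(2) mult_pos_pos[OF c(2) c(2)] by linarith
    qed
    then have "s * ((1 + c\<^sub>2) * (1 - 2 * c\<^sub>2) + (2 / 10) * c\<^sub>2) \<le> s * (1 - \<theta>)"
      using s by (intro mult_left_mono) auto
    moreover have "s * (1 + c\<^sub>2) * (1 - 2 * c\<^sub>2) + s * ((2 / 10) * c\<^sub>2)
        = s * ((1 + c\<^sub>2) * (1 - 2 * c\<^sub>2) + (2 / 10) * c\<^sub>2)"
      by (simp add: field_simps)
    moreover have "s * (1 - \<theta>) = (1 - \<theta>) * s" by (rule mult.commute)
    ultimately show ?thesis by linarith
  qed
  \<comment> \<open>Here the negative term of the descent absorbs the mean gradient;
    \<open>\<eta> \<le> \<gamma>\<close> reduces it to the bound on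
    \<open>\<gamma> * K\<close>.\<close>
  have cg: "4 * K * \<eta>\<^sup>2 \<le> \<eta> / 4"
  proof -
    have "4 * K * \<eta>\<^sup>2 = (4 * \<eta>) * (\<eta> * K)" by (simp add: power2_eq_square)
    also have "\<dots> \<le> (4 * \<eta>) * (\<gamma> * K)" using \<eta> K_pos by (intro mult_left_mono mult_right_mono) auto
    also have "\<dots> \<le> (4 * \<eta>) * (127 / 10000)" using \<gamma>K s \<eta> by (intro mult_left_mono) auto
    finally show ?thesis using \<eta> by simp
  qed

  have 1: "\<phi> * b' \<le> \<phi> * b - (99 / 100) * (\<gamma> * \<phi>) * d + (41 / 10) * \<gamma> * \<phi> * N\<^sub>Y + \<phi> * (u * L\<^sup>2) * D"
    using mult_left_mono[OF b'[folded u_def], of \<phi>] \<phi>_pos by (simp add: field_simps)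
  have 2: "s * f' \<le> s * (1 + c\<^sub>2) * (1 - 2 * c\<^sub>2) * f + s * (1 + c\<^sub>2) * p\<^sub>Y * w\<^sub>Y
      + 6 * s * i\<^sub>2 * \<gamma>\<^sup>2 * d + 12 * s * i\<^sub>2 * \<gamma>\<^sup>2 * N\<^sub>Y + s * (3 * i\<^sub>2 * L\<^sup>2) * D"
  proof -
    have "s * f' \<le> s * ((1 + c\<^sub>2) * ((1 - 2 * c\<^sub>2) * f + p\<^sub>Y * w\<^sub>Y)
      + i\<^sub>2 * (3 * (2 * \<gamma>\<^sup>2 * d + 4 * \<gamma>\<^sup>2 * N\<^sub>Y + L\<^sup>2 * D)))"
      using f' s by (intro mult_left_mono) (auto simp: i_def)
    also have "\<dots> = s * (1 + c\<^sub>2) * (1 - 2 * c\<^sub>2) * f + s * (1 + c\<^sub>2) * p\<^sub>Y * w\<^sub>Y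
      + 6 * s * i\<^sub>2 * \<gamma>\<^sup>2 * d + 12 * s * i\<^sub>2 * \<gamma>\<^sup>2 * N\<^sub>Y + s * (3 * i\<^sub>2 * L\<^sup>2) * D"
      by (simp add: algebra_simps)
    finally show ?thesis .
  qed
  have 3: "K * D \<le> 16 * \<gamma>\<^sup>2 * K * a + 16 * \<gamma>\<^sup>2 * K * N\<^sub>X + 4 * K * \<eta>\<^sup>2 * b + 4 * K * \<eta>\<^sup>2 * g"
    using mult_left_mono[OF D, of K] K_pos by (simp add: algebra_simps)
  have 4: "M\<^sub>X * N\<^sub>X \<le> M\<^sub>X * C * e + M\<^sub>X * R * w\<^sub>X"
    using mult_left_mono[OF N(1), of M\<^sub>X] M_pos by (simp add: algebra_simps)
  have 5: "M\<^sub>Y * N\<^sub>Y \<le> M\<^sub>Y * C * f + M\<^sub>Y * R * w\<^sub>Y"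
    using mult_left_mono[OF N(2), of M\<^sub>Y] M_pos by (simp add: algebra_simps)
  have d_nonneg: "0 \<le> d" using d s nonneg(2) mult_nonneg_nonneg[of s b] by linarith
  \<comment> \<open>The drift is first charged to \<open>d\<close>, and only the surplus is
    converted by \<open>s * b \<le> d\<close>. In the other order the factor \<open>s\<close> would
    be lost before the comparison.\<close>
  have 6: "6 * s * i\<^sub>2 * \<gamma>\<^sup>2 * d - (99 / 100) * (\<gamma> * \<phi>) * d \<le> - ((94 / 100) * (\<gamma> * \<phi>) * s * b)"
  proof -
    have "6 * s * i\<^sub>2 * \<gamma>\<^sup>2 * d - (99 / 100) * (\<gamma> * \<phi>) * d \<le> (48 / 1000) * (\<gamma> * \<phi>) * d - (99 / 100) * (\<gamma> * \<phi>) * d"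
      using mult_right_mono[OF cd d_nonneg] by linarith
    also have "\<dots> \<le> - ((94 / 100) * (\<gamma> * \<phi>) * d)"
      using mult_nonneg_nonneg[OF mult_nonneg_nonneg[of \<gamma> \<phi>] d_nonneg] \<gamma>(1) \<phi>_pos by linarith
    also have "\<dots> \<le> - ((94 / 100) * (\<gamma> * \<phi>) * (s * b))"
      using d \<gamma> \<phi>_pos by (simp add: mult_ac)
    finally show ?thesis by (simp add: mult_ac)
  qed
  have 7: "i\<^sub>1 * D + \<phi> * (u * L\<^sup>2) * D + s * (3 * i\<^sub>2 * L\<^sup>2) * D = K * D"
    unfolding K_eq by (simp add: distrib_right)
  have M: "M\<^sub>X * N\<^sub>X = (41 / 10) * \<gamma> * N\<^sub>X + 16 * \<gamma>\<^sup>2 * K * N\<^sub>X"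
    "M\<^sub>Y * N\<^sub>Y = (41 / 10) * \<gamma> * \<phi> * N\<^sub>Y + 12 * s * i\<^sub>2 * \<gamma>\<^sup>2 * N\<^sub>Y"
    unfolding M_def by (simp_all only: distrib_right)
  have e'': "e' \<le> (1 + c\<^sub>1) * (1 - 2 * c\<^sub>1) * e + (1 + c\<^sub>1) * p\<^sub>X * w\<^sub>X + i\<^sub>1 * D"
    using e'[folded i_def] by (simp add: algebra_simps)
  have a'': "a' \<le> a - (99 / 100) * \<gamma> * s * a + (41 / 10) * \<gamma> * N\<^sub>X + u * \<eta>\<^sup>2 * b"
    using a'[folded u_def] by (simp only: mult.assoc)
  have cg': "4 * K * \<eta>\<^sup>2 - \<eta> / 4 \<le> 0" and cG: "1 - \<nu> * \<eta> \<le> 1 - \<theta>"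
    using cg \<theta>(4) by linarith+
  have "a' + \<phi> * b' + e' + s * f' + G' \<le>
      (1 - (99 / 100) * \<gamma> * s + \<eta> / 2 * L\<^sup>2 + 16 * \<gamma>\<^sup>2 * K) * a
      + (\<phi> + u * \<eta>\<^sup>2 + 4 * K * \<eta>\<^sup>2 - (94 / 100) * (\<gamma> * \<phi>) * s) * b
      + ((1 + c\<^sub>1) * (1 - 2 * c\<^sub>1) + M\<^sub>X * C) * e
      + (s * (1 + c\<^sub>2) * (1 - 2 * c\<^sub>2) + M\<^sub>Y * C) * f
      + (4 * K * \<eta>\<^sup>2 - \<eta> / 4) * g + (1 - \<nu> * \<eta>) * G
      + (M\<^sub>X * R + (1 + c\<^sub>1) * p\<^sub>X) * w\<^sub>X + (M\<^sub>Y * R + s * (1 + c\<^sub>2) * p\<^sub>Y) * w\<^sub>Y"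
    (is "_ \<le> ?r")
  proof -
    have "?r = (a - (99 / 100) * \<gamma> * s * a + \<eta> / 2 * L\<^sup>2 * a + 16 * \<gamma>\<^sup>2 * K * a)
      + (\<phi> * b + u * \<eta>\<^sup>2 * b + 4 * K * \<eta>\<^sup>2 * b - (94 / 100) * (\<gamma> * \<phi>) * s * b)
      + ((1 + c\<^sub>1) * (1 - 2 * c\<^sub>1) * e + M\<^sub>X * C * e)
      + (s * (1 + c\<^sub>2) * (1 - 2 * c\<^sub>2) * f + M\<^sub>Y * C * f)
      + (4 * K * \<eta>\<^sup>2 * g - \<eta> / 4 * g) + (1 - \<nu> * \<eta>) * G
      + (M\<^sub>X * R * w\<^sub>X + (1 + c\<^sub>1) * p\<^sub>X * w\<^sub>X) + (M\<^sub>Y * R * w\<^sub>Y + s * (1 + c\<^sub>2) * p\<^sub>Y * w\<^sub>Y)"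
      by (simp only: distrib_right left_diff_distrib mult_1_left)
    then show ?thesis using a'' 1 e'' 2 G' 3 4 5 6 7 M by linarith
  qed
  also have "\<dots> \<le> (1 - \<theta>) * a + ((1 - \<theta>) * \<phi>) * b + (1 - \<theta>) * e + ((1 - \<theta>) * s) * f + 0 * g + (1 - \<theta>) * G
      + (M\<^sub>X * R + (1 + c\<^sub>1) * p\<^sub>X) * w\<^sub>X + (M\<^sub>Y * R + s * (1 + c\<^sub>2) * p\<^sub>Y) * w\<^sub>Y"
    by (rule add_right_mono, rule add_right_mono,
        intro add_mono mult_right_mono ca cb ce cf cg' cG nonneg)
  also have "\<dots> = (1 - \<theta>) * (a + \<phi> * b + e + s * f + G)
      + (M\<^sub>X * R + (1 + c\<^sub>1) * p\<^sub>X) * w\<^sub>X + (M\<^sub>Y * R + s * (1 + c\<^sub>2) * p\<^sub>Y) * w\<^sub>Y"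
    by (simp add: distrib_left mult.assoc)
  finally show ?thesis unfolding M_def i_def .
qed

section \<open>The recursion for the algorithm's vectors\<close>

text \<open>The step size bounds are in product form, which is meaningful for \<open>C = 0\<close>
  too. \<open>\<theta>\<close> is any number below the four limiting rates, so the recursion does
  not depend on how \<open>\<theta>\<^sub>4\<close> is assembled.\<close>

locale compressed_tracking =
  fixes E :: "('n::finite \<times> 'n) set" and W :: "real ^ 'n ^ 'n"
    and F :: "'n \<Rightarrow> real ^ 'd \<Rightarrow> real"
    and \<sigma> L \<nu> r \<psi> \<phi>\<^sub>X \<phi>\<^sub>Y \<gamma> \<eta> c\<^sub>1 c\<^sub>2 C \<phi> \<theta> :: real
  assumes W: "doubly_stochastic_weights E W"
    and \<sigma>: "\<sigma> = spectral_norm (W - (\<chi> i j. 1 / real CARD('n)))" "0 < \<sigma>" "\<sigma> < 1"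
    and F_diff: "\<And>i x. F i differentiable (at x)"
    and F_argmin: "argmin (mean_cost F) \<noteq> {}"
    and L: "0 < L" "\<And>i x y. norm (grad (F i) x - grad (F i) y) \<le> L * norm (x - y)"
    and PL: "PL_condition (mean_cost F) \<nu>"
    and r: "0 < r" and \<psi>: "0 < \<psi>" "\<psi> \<le> 1"
    and \<phi>X: "0 < \<phi>\<^sub>X" "\<phi>\<^sub>X < 1 / r" and \<phi>Y: "0 < \<phi>\<^sub>Y" "\<phi>\<^sub>Y < 1 / r"
    and c1: "c\<^sub>1 = \<phi>\<^sub>X * \<psi> * r / 2" and c2: "c\<^sub>2 = \<phi>\<^sub>Y * \<psi> * r / 2"
    and C: "C = 2 * r\<^sup>2 * (1 - \<psi>) + 2 * (1 - r)\<^sup>2"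
    and \<gamma>: "0 < \<gamma>" "\<gamma> * (1 + inverse c\<^sub>1) \<le> (1 - \<sigma>) / 160"
      "\<gamma> * (1 + inverse c\<^sub>2) * L\<^sup>2 \<le> (1 - \<sigma>) / 40000"
      "\<gamma> * C \<le> c\<^sub>1 * (1 - \<sigma>) / 40" "\<gamma> * C \<le> c\<^sub>2 * L\<^sup>2" "\<gamma>\<^sup>2 * C \<le> c\<^sub>2\<^sup>2 / 100"
    and \<eta>: "0 < \<eta>" "\<eta> * L \<le> (1 - \<sigma>)\<^sup>2 * \<gamma> / 40" "\<eta> * L\<^sup>2 \<le> (4 / 10) * (1 - \<sigma>) * \<gamma>" "\<eta> \<le> \<gamma>"
      "\<eta> \<le> 1 / (2 * L)"
    and \<phi>: "\<phi> = (1 - \<sigma>)\<^sup>2 / (320 * L\<^sup>2)"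
    and \<theta>: "\<theta> \<le> (7 / 100) * (1 - \<sigma>) * \<gamma>" "\<theta> \<le> (44 / 100) * c\<^sub>1 * (2 * c\<^sub>1 + 1)"
      "\<theta> \<le> (77 / 100) * c\<^sub>2 * (2 * c\<^sub>2 + 1)" "\<theta> \<le> \<nu> * \<eta>"
begin

lemma c_bounds: "0 < c\<^sub>1" "c\<^sub>1 \<le> 1 / 2" "0 < c\<^sub>2" "c\<^sub>2 \<le> 1 / 2"
proof -
  have "\<phi>\<^sub>X * r < 1" "\<phi>\<^sub>Y * r < 1" using \<phi>X \<phi>Y r by (auto simp: field_simps)
  then have "(\<phi>\<^sub>X * r) * \<psi> \<le> 1 * 1" "(\<phi>\<^sub>Y * r) * \<psi> \<le> 1 * 1"
    using \<psi> \<phi>X \<phi>Y r by (intro mult_mono; simp)+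
  then show "0 < c\<^sub>1" "c\<^sub>1 \<le> 1 / 2" "0 < c\<^sub>2" "c\<^sub>2 \<le> 1 / 2"
    using \<psi> \<phi>X \<phi>Y r by (auto simp: c1 c2 mult_ac)
qed

text \<open>From \<open>c\<^sub>1 \<le> 1 / 2\<close> the factor
  \<open>1 + inverse c\<^sub>1\<close> is at least 3, and \<open>160 * 3 = 480\<close>.\<close>

lemma \<gamma>_le: "\<gamma> \<le> 1 / 480"
proof -
  have "3 \<le> 1 + inverse c\<^sub>1" using c_bounds by (simp add: field_simps)
  then have "\<gamma> * 3 \<le> \<gamma> * (1 + inverse c\<^sub>1)" using \<gamma> by (intro mult_left_mono) auto
  then show ?thesis using \<gamma>(2) \<sigma> by simp
qed

lemma C_nonneg: "0 \<le> C" using \<psi> by (simp add: C)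

text \<open>Keeps \<open>1 - \<theta>\<close> nonnegative, so that the recursion can be
  iterated.\<close>

lemma \<theta>_le_1: "\<theta> \<le> 1"
proof -
  have "(7 / 100) * (1 - \<sigma>) * \<gamma> \<le> 1 * (1 / 480)"
    using \<sigma>(2,3) \<gamma>(1) \<gamma>_le by (intro mult_mono) auto
  then show ?thesis using \<theta>(1) by linarith
qed

lemma \<phi>_pos: "0 < \<phi>" using \<sigma>(2,3) L by (simp add: \<phi>)

text \<open>Compared with \<open>U_fun\<close>, the tracking compression error is damped by \<open>1 - \<sigma>\<close>: with
  weight \<open>1\<close> its increments outweigh the damping of \<open>Y\<close> in this argument when \<open>1 - \<sigma>\<close> is small.\<close>

definition lyapunov :: "real ^ 'd ^ 'n \<Rightarrow> real ^ 'd ^ 'n \<Rightarrow> real ^ 'd ^ 'n \<Rightarrow> real ^ 'd ^ 'n \<Rightarrow> real" where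
  "lyapunov X Y A Z = (norm (X - rep_avg X))\<^sup>2 + \<phi> * (norm (Y - rep_avg Y))\<^sup>2 + (norm (X - A))\<^sup>2
    + (1 - \<sigma>) * (norm (Y - Z))\<^sup>2 + optimality_gap F X"

text \<open>Needed at time 0 only; at time \<open>k\<close> the target quantity is compared with
  \<open>lyapunov\<close> directly.\<close>

lemma lyapunov_le_U_fun: "lyapunov X Y A Z \<le> U_fun F \<phi> X Y A Z"
  using \<sigma>(2,3) mult_left_le_one_le[of "(norm (Y - Z))\<^sup>2" "1 - \<sigma>"]
  by (simp add: lyapunov_def U_fun_def V_fun_def)

lemma gap_le_lyapunov: "(norm (X - rep_avg X))\<^sup>2 + optimality_gap F X \<le> lyapunov X Y A Z"
  using \<sigma>(2,3) \<phi>_pos by (simp add: lyapunov_def)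

text \<open>Transfers integrability from \<open>lyapunov\<close> to the compression errors.\<close>

lemma compression_errors_le_lyapunov:
  "(norm (X - A))\<^sup>2 \<le> lyapunov X Y A Z" "(norm (Y - Z))\<^sup>2 \<le> lyapunov X Y A Z / (1 - \<sigma>)"
proof -
  note gap = optimality_gap_nonneg[OF F_argmin, of X]
  show "(norm (X - A))\<^sup>2 \<le> lyapunov X Y A Z"
    using gap \<sigma>(2,3) \<phi>_pos by (simp add: lyapunov_def)
  have "(1 - \<sigma>) * (norm (Y - Z))\<^sup>2 \<le> lyapunov X Y A Z"
    using gap \<sigma>(2,3) \<phi>_pos by (simp add: lyapunov_def)
  then show "(norm (Y - Z))\<^sup>2 \<le> lyapunov X Y A Z / (1 - \<sigma>)"
    using \<sigma>(2,3) by (simp add: field_simps)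
qed

lemma lyapunov_nonneg: "0 \<le> lyapunov X Y A Z"
  using compression_errors_le_lyapunov(1)[of X A Y Z] zero_le_power2[of "norm (X - A)"] by linarith

text \<open>The total weight of the squared displacement of \<open>X\<close>. The summands stem from
  the gradient differences in the tracking error, from the compression error of \<open>X\<close> and
  from that of \<open>Y\<close>.\<close>

definition increment_weight :: real where
  "increment_weight = \<phi> * ((201 / 100) / (\<gamma> * (1 - \<sigma>)) * L\<^sup>2) + (1 + inverse c\<^sub>1)
    + (1 - \<sigma>) * (3 * (1 + inverse c\<^sub>2) * L\<^sup>2)"

text \<open>The first summand collects the noise that enters through mixing, the second the update
  of \<open>A\<close>. Only the sign matters, as it multiplies an excess of nonpositive
  expectation.\<close>

definition noise_weight_X :: real where
  "noise_weight_X = ((41 / 10) * \<gamma> + 16 * \<gamma>\<^sup>2 * increment_weight) * (2 * r\<^sup>2) + (1 + c\<^sub>1) * (\<phi>\<^sub>X * r)"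

definition noise_weight_Y :: real where
  "noise_weight_Y = ((41 / 10) * \<gamma> * \<phi> + 12 * (1 - \<sigma>) * (1 + inverse c\<^sub>2) * \<gamma>\<^sup>2) * (2 * r\<^sup>2)
    + (1 - \<sigma>) * (1 + c\<^sub>2) * (\<phi>\<^sub>Y * r)"

lemma noise_weights_nonneg: "0 \<le> noise_weight_X" "0 \<le> noise_weight_Y"
proof -
  have "0 \<le> increment_weight"
    unfolding increment_weight_def using \<phi>_pos \<gamma> \<sigma> c_bounds by simp
  then show "0 \<le> noise_weight_X" "0 \<le> noise_weight_Y"
    unfolding noise_weight_X_def noise_weight_Y_def using \<phi>_pos \<gamma>(1) \<sigma> c_bounds \<phi>X \<phi>Y r by simp_all
qed

text \<open>Subtracting the contraction bound inside \<open>w\<close> leaves exactly the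
  deterministic factors that would hold in expectation, while the estimates stay pathwise.\<close>

lemma compression_bounds:
  fixes q e :: "real ^ 'd ^ 'n"
  defines "w \<equiv> (norm (q /\<^sub>R r - e))\<^sup>2 - (1 - \<psi>) * (norm e)\<^sup>2"
  assumes p: "0 < p" "p < 1 / r"
  shows "(norm (q - e))\<^sup>2 \<le> C * (norm e)\<^sup>2 + 2 * r\<^sup>2 * w"
    and "(norm (e - p *\<^sub>R q))\<^sup>2 \<le> (1 - 2 * (p * \<psi> * r / 2)) * (norm e)\<^sup>2 + p * r * w"
  using compression_noise_sq_le[OF r, of q e] compressed_update_sq_le[OF r p, of e q]
  by (simp_all add: w_def C algebra_simps)

text \<open>The messages \<open>Q\<^sub>X\<close>, \<open>Q\<^sub>Y\<close> are arbitrary here: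
  everything about the compressor sits in the two excess terms.\<close>

lemma lyapunov_step:
  fixes X Y A Z Q\<^sub>X Q\<^sub>Y X' Y' :: "real ^ 'd ^ 'n"
  assumes Y_avg: "avg Y = avg (stacked_grad F X)"
    and X': "X' = X - \<gamma> *\<^sub>R (mix_residual W A + mix_residual W Q\<^sub>X) - \<eta> *\<^sub>R Y"
    and Y': "Y' = Y - \<gamma> *\<^sub>R (mix_residual W Z + mix_residual W Q\<^sub>Y) + stacked_grad F X' - stacked_grad F X"
  shows "lyapunov X' Y' (A + \<phi>\<^sub>X *\<^sub>R Q\<^sub>X) (Z + \<phi>\<^sub>Y *\<^sub>R Q\<^sub>Y) \<le> (1 - \<theta>) * lyapunov X Y A Z
    + noise_weight_X * ((norm (Q\<^sub>X /\<^sub>R r - (X - A)))\<^sup>2 - (1 - \<psi>) * (norm (X - A))\<^sup>2)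
    + noise_weight_Y * ((norm (Q\<^sub>Y /\<^sub>R r - (Y - Z)))\<^sup>2 - (1 - \<psi>) * (norm (Y - Z))\<^sup>2)"
proof -
  define n\<^sub>X where "n\<^sub>X = Q\<^sub>X - (X - A)"
  define n\<^sub>Y where "n\<^sub>Y = Q\<^sub>Y - (Y - Z)"
  define h where "h = stacked_grad F X' - stacked_grad F X"
  define D where "D = (norm (X' - X))\<^sup>2"
  define d where "d = (Y - rep_avg Y) \<bullet> mix_residual W Y"
  note mix_lin = linear_add[OF linear_mix_residual] linear_diff[OF linear_mix_residual]
  \<comment> \<open>\<open>A\<close> cancels because \<open>A + Q\<^sub>X = X + n\<^sub>X\<close>;
    likewise \<open>Z\<close> in the next equation.\<close>
  have X'_eq: "X' = X - \<gamma> *\<^sub>R mix_residual W X - \<gamma> *\<^sub>R mix_residual W n\<^sub>X + (- \<eta> *\<^sub>R Y)"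
    by (simp add: X' n\<^sub>X_def mix_lin algebra_simps)
  have Y'_eq: "Y' = Y - \<gamma> *\<^sub>R mix_residual W Y - \<gamma> *\<^sub>R mix_residual W n\<^sub>Y + h"
    by (simp add: Y' n\<^sub>Y_def h_def mix_lin algebra_simps)
  have scaled_mix: "(norm (c *\<^sub>R mix_residual W x))\<^sup>2 \<le> 4 * c\<^sup>2 * (norm y)\<^sup>2"
    if "norm (mix_residual W x) \<le> 2 * norm y" for c and x y :: "real ^ 'd ^ 'n"
  proof -
    have "(norm (mix_residual W x))\<^sup>2 \<le> (2 * norm y)\<^sup>2" using that by (intro power_mono) auto
    then have "c\<^sup>2 * (norm (mix_residual W x))\<^sup>2 \<le> c\<^sup>2 * (2 * norm y)\<^sup>2" by (intro mult_left_mono) auto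
    then show ?thesis by (simp add: power_mult_distrib)
  qed
  have D_le: "D \<le> 4 * (4 * \<gamma>\<^sup>2 * (norm (X - rep_avg X))\<^sup>2 + 4 * \<gamma>\<^sup>2 * (norm n\<^sub>X)\<^sup>2
      + \<eta>\<^sup>2 * (norm (Y - rep_avg Y))\<^sup>2 + \<eta>\<^sup>2 * (norm (rep_avg Y))\<^sup>2)"
  proof -
    \<comment> \<open>\<open>Y\<close> is split at its average: the centred part is damped by
      tracking, the average is the descent direction.\<close>
    have "X' - X = (- \<gamma>) *\<^sub>R mix_residual W X + (- \<gamma>) *\<^sub>R mix_residual W n\<^sub>X
        + (- \<eta>) *\<^sub>R (Y - rep_avg Y) + (- \<eta>) *\<^sub>R rep_avg Y"
      by (simp add: X'_eq algebra_simps)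
    then have "D \<le> 4 * ((norm ((- \<gamma>) *\<^sub>R mix_residual W X))\<^sup>2 + (norm ((- \<gamma>) *\<^sub>R mix_residual W n\<^sub>X))\<^sup>2
        + (norm ((- \<eta>) *\<^sub>R (Y - rep_avg Y)))\<^sup>2 + (norm ((- \<eta>) *\<^sub>R rep_avg Y))\<^sup>2)"
      unfolding D_def by (metis norm_add4_sq_le)
    also have "\<dots> \<le> 4 * (4 * (- \<gamma>)\<^sup>2 * (norm (X - rep_avg X))\<^sup>2 + 4 * (- \<gamma>)\<^sup>2 * (norm n\<^sub>X)\<^sup>2
        + \<eta>\<^sup>2 * (norm (Y - rep_avg Y))\<^sup>2 + \<eta>\<^sup>2 * (norm (rep_avg Y))\<^sup>2)"
      by (intro mult_left_mono add_mono scaled_mix mix_residual_bounds[OF W \<sigma>])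
        (auto simp: power_mult_distrib)
    finally show ?thesis by simp
  qed
  have h_sq: "(norm h)\<^sup>2 \<le> L\<^sup>2 * D"
  proof -
    have "norm h \<le> L * norm (X' - X)"
      unfolding h_def using L by (intro norm_stacked_grad_diff_le) auto
    then have "(norm h)\<^sup>2 \<le> (L * norm (X' - X))\<^sup>2" by (intro power_mono) auto
    then show ?thesis by (simp add: power_mult_distrib D_def)
  qed
  have gain: "0 \<le> (201 / 100) / (\<gamma> * (1 - \<sigma>))" using \<gamma> \<sigma> by simp
  have a': "(norm (X' - rep_avg X'))\<^sup>2 \<le> (norm (X - rep_avg X))\<^sup>2
      - (99 / 100) * \<gamma> * ((1 - \<sigma>) * (norm (X - rep_avg X))\<^sup>2) + (41 / 10) * \<gamma> * (norm n\<^sub>X)\<^sup>2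
      + (201 / 100) / (\<gamma> * (1 - \<sigma>)) * (\<eta>\<^sup>2 * (norm (Y - rep_avg Y))\<^sup>2)"
  proof -
    have "- \<eta> *\<^sub>R Y - rep_avg (- \<eta> *\<^sub>R Y) = - \<eta> *\<^sub>R (Y - rep_avg Y)"
      using linear_cmul[OF linear_rep_avg, of "- \<eta>" Y] by (simp add: algebra_simps)
    then have "(norm (- \<eta> *\<^sub>R Y - rep_avg (- \<eta> *\<^sub>R Y)))\<^sup>2 = \<eta>\<^sup>2 * (norm (Y - rep_avg Y))\<^sup>2"
      by (simp add: power_mult_distrib)
    moreover have "(99 / 100) * \<gamma> * ((1 - \<sigma>) * (norm (X - rep_avg X))\<^sup>2)
        \<le> (99 / 100) * \<gamma> * ((X - rep_avg X) \<bullet> mix_residual W X)"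
      using \<gamma> by (intro mult_left_mono mix_residual_bounds[OF W \<sigma>]) auto
    ultimately show ?thesis
      using consensus_step[OF W \<sigma> \<gamma>(1) \<gamma>_le X'_eq] by simp
  qed
  have b': "(norm (Y' - rep_avg Y'))\<^sup>2 \<le> (norm (Y - rep_avg Y))\<^sup>2
      - (99 / 100) * \<gamma> * d + (41 / 10) * \<gamma> * (norm n\<^sub>Y)\<^sup>2
      + (201 / 100) / (\<gamma> * (1 - \<sigma>)) * (L\<^sup>2 * D)"
  proof -
    have "(norm (h - rep_avg h))\<^sup>2 \<le> (norm h)\<^sup>2" by (intro power_mono norm_diff_rep_avg_le) auto
    from mult_left_mono[OF order_trans[OF this h_sq] gain]
    have "(201 / 100) / (\<gamma> * (1 - \<sigma>)) * (norm (h - rep_avg h))\<^sup>2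
        \<le> (201 / 100) / (\<gamma> * (1 - \<sigma>)) * (L\<^sup>2 * D)" .
    then show ?thesis
      using consensus_step[OF W \<sigma> \<gamma>(1) \<gamma>_le Y'_eq] unfolding d_def by linarith
  qed
  have e': "(norm (X' - (A + \<phi>\<^sub>X *\<^sub>R Q\<^sub>X)))\<^sup>2 \<le> (1 + c\<^sub>1) * ((1 - 2 * c\<^sub>1) * (norm (X - A))\<^sup>2
      + \<phi>\<^sub>X * r * ((norm (Q\<^sub>X /\<^sub>R r - (X - A)))\<^sup>2 - (1 - \<psi>) * (norm (X - A))\<^sup>2)) + (1 + inverse c\<^sub>1) * D"
  proof -
    have "X' - (A + \<phi>\<^sub>X *\<^sub>R Q\<^sub>X) = ((X - A) - \<phi>\<^sub>X *\<^sub>R Q\<^sub>X) + (X' - X)" by simp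
    then have "(norm (X' - (A + \<phi>\<^sub>X *\<^sub>R Q\<^sub>X)))\<^sup>2
        \<le> (1 + c\<^sub>1) * (norm ((X - A) - \<phi>\<^sub>X *\<^sub>R Q\<^sub>X))\<^sup>2 + (1 + inverse c\<^sub>1) * D"
      unfolding D_def using norm_add_sq_le[OF c_bounds(1)] by metis
    then show ?thesis
      using mult_left_mono[OF compression_bounds(2)[OF \<phi>X, of "X - A" Q\<^sub>X, folded c1], of "1 + c\<^sub>1"] c_bounds
      by linarith
  qed
  have f': "(norm (Y' - (Z + \<phi>\<^sub>Y *\<^sub>R Q\<^sub>Y)))\<^sup>2 \<le> (1 + c\<^sub>2) * ((1 - 2 * c\<^sub>2) * (norm (Y - Z))\<^sup>2
      + \<phi>\<^sub>Y * r * ((norm (Q\<^sub>Y /\<^sub>R r - (Y - Z)))\<^sup>2 - (1 - \<psi>) * (norm (Y - Z))\<^sup>2))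
      + (1 + inverse c\<^sub>2) * (3 * (2 * \<gamma>\<^sup>2 * d + 4 * \<gamma>\<^sup>2 * (norm n\<^sub>Y)\<^sup>2 + L\<^sup>2 * D))"
  proof -
    have "Y' - Y = (- \<gamma>) *\<^sub>R mix_residual W Y + (- \<gamma>) *\<^sub>R mix_residual W n\<^sub>Y + h"
      by (simp add: Y'_eq)
    then have "(norm (Y' - Y))\<^sup>2 \<le> 3 * ((norm ((- \<gamma>) *\<^sub>R mix_residual W Y))\<^sup>2
        + (norm ((- \<gamma>) *\<^sub>R mix_residual W n\<^sub>Y))\<^sup>2 + (norm h)\<^sup>2)"
      by (metis norm_add3_sq_le)
    \<comment> \<open>Bounded by the dissipation and not by the centred norm, so that it can be
      cancelled against the damping in \<open>b'\<close>.\<close>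
    also have "(norm ((- \<gamma>) *\<^sub>R mix_residual W Y))\<^sup>2 \<le> 2 * \<gamma>\<^sup>2 * d"
      using mult_left_mono[OF mix_residual_bounds(2)[OF W \<sigma>, of Y], of "\<gamma>\<^sup>2"]
      by (simp add: power_mult_distrib d_def)
    also have "(norm ((- \<gamma>) *\<^sub>R mix_residual W n\<^sub>Y))\<^sup>2 \<le> 4 * (- \<gamma>)\<^sup>2 * (norm n\<^sub>Y)\<^sup>2"
      by (intro scaled_mix mix_residual_bounds[OF W \<sigma>])
    also note h_sq
    finally have "(norm (Y' - Y))\<^sup>2 \<le> 3 * (2 * \<gamma>\<^sup>2 * d + 4 * \<gamma>\<^sup>2 * (norm n\<^sub>Y)\<^sup>2 + L\<^sup>2 * D)" by simp
    then have inc: "(1 + inverse c\<^sub>2) * (norm (Y' - Y))\<^sup>2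
        \<le> (1 + inverse c\<^sub>2) * (3 * (2 * \<gamma>\<^sup>2 * d + 4 * \<gamma>\<^sup>2 * (norm n\<^sub>Y)\<^sup>2 + L\<^sup>2 * D))"
      using c_bounds by (intro mult_left_mono) auto
    have "Y' - (Z + \<phi>\<^sub>Y *\<^sub>R Q\<^sub>Y) = ((Y - Z) - \<phi>\<^sub>Y *\<^sub>R Q\<^sub>Y) + (Y' - Y)" by simp
    then have "(norm (Y' - (Z + \<phi>\<^sub>Y *\<^sub>R Q\<^sub>Y)))\<^sup>2
        \<le> (1 + c\<^sub>2) * (norm ((Y - Z) - \<phi>\<^sub>Y *\<^sub>R Q\<^sub>Y))\<^sup>2 + (1 + inverse c\<^sub>2) * (norm (Y' - Y))\<^sup>2"
      using norm_add_sq_le[OF c_bounds(3)] by metis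
    then show ?thesis
      using inc mult_left_mono[OF compression_bounds(2)[OF \<phi>Y, of "Y - Z" Q\<^sub>Y, folded c2], of "1 + c\<^sub>2"] c_bounds
      by linarith
  qed
  \<comment> \<open>Gradient tracking identifies the average in \<open>D_le\<close> with the mean
    gradient of the descent estimate.\<close>
  have "rep_avg Y = rep_avg (stacked_grad F X)" by (simp add: rep_avg_def Y_avg)
  moreover have "avg X' = avg X - \<eta> *\<^sub>R avg (stacked_grad F X)"
    by (simp add: X' linear_diff[OF linear_avg] linear_add[OF linear_avg] linear_cmul[OF linear_avg]
        avg_mix_residual[OF W] Y_avg)
  ultimately have G': "optimality_gap F X' \<le> (1 - \<nu> * \<eta>) * optimality_gap F X
      - \<eta> / 4 * (norm (rep_avg Y))\<^sup>2 + \<eta> / 2 * L\<^sup>2 * (norm (X - rep_avg X))\<^sup>2"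
    using optimality_gap_step[OF F_diff L PL \<eta>(1) \<eta>(5)] by simp
  have s: "0 < 1 - \<sigma>" "1 - \<sigma> \<le> 1" using \<sigma>(2,3) by simp_all
  show ?thesis
    unfolding lyapunov_def noise_weight_X_def noise_weight_Y_def
    by (rule lyapunov_step_arithmetic[OF s L(1) C_nonneg c_bounds(1,3,4) \<gamma> \<eta>(1-4) \<phi> \<theta>
          increment_weight_def zero_le_power2 zero_le_power2 zero_le_power2 zero_le_power2 zero_le_power2
          optimality_gap_nonneg[OF F_argmin] mix_residual_bounds(1)[OF W \<sigma>, of Y, folded d_def]
          compression_bounds(1)[OF \<phi>X, of Q\<^sub>X "X - A", folded n\<^sub>X_def]
          compression_bounds(1)[OF \<phi>Y, of Q\<^sub>Y "Y - Z", folded n\<^sub>Y_def]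
          D_le a' b' e' f' G'])
qed

end

subsection \<open>Compression with fresh seeds\<close>

text \<open>A vector is the sum of its components placed on the axes, and each \<open>axis i\<close>
  is linear, hence continuous.\<close>

lemma borel_measurable_vecI:
  fixes f :: "'w \<Rightarrow> 'a::euclidean_space ^ 'n"
  assumes "\<And>i. (\<lambda>\<omega>. f \<omega> $ i) \<in> borel_measurable N"
  shows "f \<in> borel_measurable N"
proof -
  have "linear (axis i :: 'a \<Rightarrow> 'a ^ 'n)" for i
    by (rule linearI) (auto simp: axis_def vec_eq_iff)
  then have "continuous_on UNIV (axis i :: 'a \<Rightarrow> 'a ^ 'n)" for i
    by (simp add: linear_continuous_on linear_conv_bounded_linear)
  then have "(\<lambda>\<omega>. axis i (f \<omega> $ i)) \<in> borel_measurable N" for i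
    using assms[of i] by (rule borel_measurable_continuous_on)
  then have "(\<lambda>\<omega>. \<Sum>i\<in>UNIV. axis i (f \<omega> $ i)) \<in> borel_measurable N"
    by (intro borel_measurable_sum) auto
  moreover have "(\<Sum>i\<in>UNIV. axis i (x $ i)) = x" for x :: "'a ^ 'n"
    by (simp add: vec_eq_iff axis_def)
  ultimately show ?thesis by simp
qed

lemma borel_measurable_vec_nth:
  fixes f :: "'w \<Rightarrow> 'a::euclidean_space ^ 'n"
  assumes "f \<in> borel_measurable N"
  shows "(\<lambda>\<omega>. f \<omega> $ i) \<in> borel_measurable N"
  using assms by (intro borel_measurable_continuous_on[of "\<lambda>x. x $ i"]) (auto intro: continuous_intros)

lemma borel_measurable_linear:
  fixes T :: "'a::euclidean_space \<Rightarrow> 'b::euclidean_space"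
  assumes "linear T" "f \<in> borel_measurable N"
  shows "(\<lambda>\<omega>. T (f \<omega>)) \<in> borel_measurable N"
  using assms by (intro borel_measurable_continuous_on[of T])
    (auto simp: linear_continuous_on linear_conv_bounded_linear)

lemma borel_measurable_stacked_grad:
  fixes F :: "'n::finite \<Rightarrow> real ^ 'd \<Rightarrow> real"
  assumes "0 \<le> L" "\<And>i x y. norm (grad (F i) x - grad (F i) y) \<le> L * norm (x - y)"
    and "f \<in> borel_measurable N"
  shows "(\<lambda>\<omega>. stacked_grad F (f \<omega>)) \<in> borel_measurable N"
proof -
  have "L-lipschitz_on UNIV (stacked_grad F)"
    using assms norm_stacked_grad_diff_le[of L F]
    by (intro lipschitz_onI) (auto simp: dist_norm)
  then show ?thesis
    using assms by (intro borel_measurable_continuous_on[of "stacked_grad F"] lipschitz_on_continuous_on)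
qed

lemma borel_measurable_compress:
  fixes cmp :: "'s \<Rightarrow> real ^ 'd \<Rightarrow> real ^ 'd" and f :: "'w \<Rightarrow> real ^ 'd ^ 'n"
  assumes "randomized_map S cmp" "f \<in> borel_measurable N" "\<And>i. u i \<in> N \<rightarrow>\<^sub>M S"
  shows "(\<lambda>\<omega>. compress cmp (\<lambda>i. u i \<omega>) (f \<omega>)) \<in> borel_measurable N"
proof (rule borel_measurable_vecI)
  fix i
  have "(\<lambda>\<omega>. (u i \<omega>, f \<omega> $ i)) \<in> N \<rightarrow>\<^sub>M S \<Otimes>\<^sub>M borel"
    by (intro measurable_Pair assms borel_measurable_vec_nth)
  from measurable_compose[OF this, of "\<lambda>(s, x). cmp s x" borel]
  have "(\<lambda>\<omega>. cmp (u i \<omega>) (f \<omega> $ i)) \<in> borel_measurable N"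
    using assms by (simp add: randomized_map_def)
  then show "(\<lambda>\<omega>. compress cmp (\<lambda>i. u i \<omega>) (f \<omega>) $ i) \<in> borel_measurable N"
    by (simp add: compress_def)
qed

section \<open>Dependence of the run on the seeds\<close>

lemma past_mono: "j \<le> k \<Longrightarrow> past j \<subseteq> past k"
  by (auto simp: past_def)

text \<open>\<open>Suc k\<close> rather than \<open>k\<close>, since the messages in the state at
  time \<open>k\<close> already use the seeds of time \<open>k\<close>.\<close>

lemma alg_run_cong:
  assumes "\<And>p. p \<in> past (Suc k) \<Longrightarrow> z p = z' p"
  shows "alg_run cmp W F \<gamma> \<eta> \<phi>\<^sub>X \<phi>\<^sub>Y X0 z k = alg_run cmp W F \<gamma> \<eta> \<phi>\<^sub>X \<phi>\<^sub>Y X0 z' k"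
  using assms
proof (induction k)
  case (Suc k)
  have "alg_run cmp W F \<gamma> \<eta> \<phi>\<^sub>X \<phi>\<^sub>Y X0 z k = alg_run cmp W F \<gamma> \<eta> \<phi>\<^sub>X \<phi>\<^sub>Y X0 z' k"
    using Suc.prems past_mono[of "Suc k" "Suc (Suc k)"] by (intro Suc.IH) auto
  then show ?case using Suc.prems by (simp add: past_def)
qed (simp add: past_def)

text \<open>The state at time \<open>k\<close> without the two messages \<open>Q\<close>: it uses only seeds of earlier times.\<close>

definition pre_state :: "('d, 'n) alg_state \<Rightarrow>
    (real ^ 'd ^ 'n) \<times> (real ^ 'd ^ 'n) \<times> (real ^ 'd ^ 'n) \<times> (real ^ 'd ^ 'n)" where
  "pre_state s = (stX s, stY s, stA s, stC s)"

text \<open>The four components at time \<open>Suc j\<close> are computed from the full state at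
  time \<open>j\<close>, which reads \<open>past (Suc j)\<close>; at time 0 they are
  constants.\<close>

lemma pre_state_alg_run_cong:
  assumes "\<And>p. p \<in> past k \<Longrightarrow> z p = z' p"
  shows "pre_state (alg_run cmp W F \<gamma> \<eta> \<phi>\<^sub>X \<phi>\<^sub>Y X0 z k) = pre_state (alg_run cmp W F \<gamma> \<eta> \<phi>\<^sub>X \<phi>\<^sub>Y X0 z' k)"
proof (cases k)
  case (Suc j)
  then have "alg_run cmp W F \<gamma> \<eta> \<phi>\<^sub>X \<phi>\<^sub>Y X0 z j = alg_run cmp W F \<gamma> \<eta> \<phi>\<^sub>X \<phi>\<^sub>Y X0 z' j"
    using assms by (intro alg_run_cong) auto
  then show ?thesis by (simp add: Suc pre_state_def alg_step_def Let_def)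
qed (simp add: pre_state_def alg_init_def)

text \<open>\<open>N\<close> is arbitrary because measurability is needed both on the sample space
  and on the product space of past seeds. All components are treated together, as each update reads
  several others.\<close>

lemma borel_measurable_alg_run:
  fixes cmp :: "'s \<Rightarrow> real ^ 'd \<Rightarrow> real ^ 'd" and F :: "'n::finite \<Rightarrow> real ^ 'd \<Rightarrow> real"
    and W :: "real ^ 'n ^ 'n" and \<gamma> \<eta> \<phi>\<^sub>X \<phi>\<^sub>Y :: real and X0 :: "real ^ 'd ^ 'n"
  assumes cmp: "randomized_map S cmp"
    and L: "0 \<le> L" "\<And>i x y. norm (grad (F i) x - grad (F i) y) \<le> L * norm (x - y)"
    and \<zeta>: "\<And>p. p \<in> past (Suc k) \<Longrightarrow> \<zeta> p \<in> N \<rightarrow>\<^sub>M S"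
  defines "run \<equiv> \<lambda>\<omega>. alg_run cmp W F \<gamma> \<eta> \<phi>\<^sub>X \<phi>\<^sub>Y X0 (\<lambda>p. \<zeta> p \<omega>)"
  shows "\<forall>f\<in>{stX, stY, stA, stB, stC, stD, stQX, stQY}. (\<lambda>\<omega>. f (run \<omega> k)) \<in> borel_measurable N"
  using \<zeta>
proof (induction k)
  case 0
  then have "\<zeta> (0, i, c) \<in> N \<rightarrow>\<^sub>M S" for i c by (simp add: past_def)
  then show ?case
    by (simp add: run_def alg_init_def borel_measurable_compress[OF cmp])
next
  case (Suc k)
  have IH: "\<forall>f\<in>{stX, stY, stA, stB, stC, stD, stQX, stQY}. (\<lambda>\<omega>. f (run \<omega> k)) \<in> borel_measurable N"
    using Suc.prems past_mono[of "Suc k" "Suc (Suc k)"] by (intro Suc.IH) auto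
  have seed: "\<zeta> (Suc k, i, c) \<in> N \<rightarrow>\<^sub>M S" for i c using Suc.prems by (simp add: past_def)
  define A' where "A' \<omega> = stA (run \<omega> k) + \<phi>\<^sub>X *\<^sub>R stQX (run \<omega> k)" for \<omega>
  define C' where "C' \<omega> = stC (run \<omega> k) + \<phi>\<^sub>Y *\<^sub>R stQY (run \<omega> k)" for \<omega>
  define X' where "X' \<omega> = stX (run \<omega> k) - \<gamma> *\<^sub>R (stB (run \<omega> k) + mix_residual W (stQX (run \<omega> k)))
    - \<eta> *\<^sub>R stY (run \<omega> k)" for \<omega>
  define Y' where "Y' \<omega> = stY (run \<omega> k) - \<gamma> *\<^sub>R (stD (run \<omega> k) + mix_residual W (stQY (run \<omega> k)))
    + stacked_grad F (X' \<omega>) - stacked_grad F (stX (run \<omega> k))" for \<omega>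
  have A': "A' \<in> borel_measurable N" and C': "C' \<in> borel_measurable N"
    and X': "X' \<in> borel_measurable N"
    unfolding A'_def[abs_def] C'_def[abs_def] X'_def[abs_def]
    by (intro borel_measurable_add borel_measurable_diff borel_measurable_scaleR measurable_const
        borel_measurable_linear[OF linear_mix_residual] IH[rule_format]; simp)+
  have Y': "Y' \<in> borel_measurable N"
    unfolding Y'_def[abs_def]
    by (intro borel_measurable_add borel_measurable_diff borel_measurable_scaleR measurable_const
        borel_measurable_linear[OF linear_mix_residual] borel_measurable_stacked_grad[OF L] X' IH[rule_format]; simp)
  have B': "(\<lambda>\<omega>. stB (run \<omega> k) + \<phi>\<^sub>X *\<^sub>R mix_residual W (stQX (run \<omega> k))) \<in> borel_measurable N"
    and D': "(\<lambda>\<omega>. stD (run \<omega> k) + \<phi>\<^sub>Y *\<^sub>R mix_residual W (stQY (run \<omega> k))) \<in> borel_measurable N"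
    by (intro borel_measurable_add borel_measurable_scaleR measurable_const
        borel_measurable_linear[OF linear_mix_residual] IH[rule_format]; simp)+
  have Q: "(\<lambda>\<omega>. compress cmp (\<lambda>i. \<zeta> (Suc k, i, XChan) \<omega>) (X' \<omega> - A' \<omega>)) \<in> borel_measurable N"
    "(\<lambda>\<omega>. compress cmp (\<lambda>i. \<zeta> (Suc k, i, YChan) \<omega>) (Y' \<omega> - C' \<omega>)) \<in> borel_measurable N"
    by (intro borel_measurable_compress[OF cmp] borel_measurable_diff X' A' Y' C' seed)+
  have "run \<omega> (Suc k) = \<lparr> stX = X' \<omega>, stY = Y' \<omega>, stA = A' \<omega>,
      stB = stB (run \<omega> k) + \<phi>\<^sub>X *\<^sub>R mix_residual W (stQX (run \<omega> k)), stC = C' \<omega>,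
      stD = stD (run \<omega> k) + \<phi>\<^sub>Y *\<^sub>R mix_residual W (stQY (run \<omega> k)),
      stQX = compress cmp (\<lambda>i. \<zeta> (Suc k, i, XChan) \<omega>) (X' \<omega> - A' \<omega>),
      stQY = compress cmp (\<lambda>i. \<zeta> (Suc k, i, YChan) \<omega>) (Y' \<omega> - C' \<omega>) \<rparr>" for \<omega>
    by (simp add: run_def alg_step_def Let_def X'_def Y'_def A'_def C'_def)
  then show ?case using A' B' C' D' X' Y' Q by simp
qed

lemma borel_measurable_pre_state:
  fixes cmp :: "'s \<Rightarrow> real ^ 'd \<Rightarrow> real ^ 'd" and F :: "'n::finite \<Rightarrow> real ^ 'd \<Rightarrow> real"
  assumes cmp: "randomized_map S cmp"
    and L: "0 \<le> L" "\<And>i x y. norm (grad (F i) x - grad (F i) y) \<le> L * norm (x - y)"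
    and \<zeta>: "\<And>p. p \<in> past k \<Longrightarrow> \<zeta> p \<in> N \<rightarrow>\<^sub>M S"
  shows "(\<lambda>\<omega>. pre_state (alg_run cmp W F \<gamma> \<eta> \<phi>\<^sub>X \<phi>\<^sub>Y X0 (\<lambda>p. \<zeta> p \<omega>) k)) \<in> borel_measurable N"
proof (cases k)
  case 0
  then show ?thesis by (simp add: pre_state_def alg_init_def)
next
  case (Suc j)
  have m: "\<forall>f\<in>{stX, stY, stA, stB, stC, stD, stQX, stQY}.
      (\<lambda>\<omega>. f (alg_run cmp W F \<gamma> \<eta> \<phi>\<^sub>X \<phi>\<^sub>Y X0 (\<lambda>p. \<zeta> p \<omega>) j)) \<in> borel_measurable N"
    using \<zeta> Suc by (intro borel_measurable_alg_run[OF cmp L]) auto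
  show ?thesis
    unfolding Suc alg_run.simps alg_step_def Let_def pre_state_def alg_state.simps
    by (intro borel_measurable_Pair borel_measurable_add borel_measurable_diff borel_measurable_scaleR
        measurable_const borel_measurable_linear[OF linear_mix_residual]
        borel_measurable_stacked_grad[OF L] m[rule_format]; simp)
qed

text \<open>By independence the joint law of the seed and the past is a product, and for a fixed
  past the compressor meets a fixed input; Fubini then reduces the claim to the contraction
  property. Nonnegative integrals are used so that integrability comes out of the same
  bound.\<close>

lemma compression_error_expectation:
  fixes cmp :: "'s \<Rightarrow> real ^ 'd \<Rightarrow> real ^ 'd" and \<zeta> :: "'n seed_index \<Rightarrow> 'w \<Rightarrow> 's"
  assumes cmp: "randomized_map S cmp" and comp: "contractive_compressor S cmp r \<psi>" and \<psi>: "\<psi> \<le> 1"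
    and M: "prob_space M" and fresh: "fresh_seeds M S \<zeta>"
    and g: "g \<in> borel_measurable (PiM (past k) (\<lambda>_. S))"
    and Z: "\<And>\<omega>. Z \<omega> = g (\<lambda>q\<in>past k. \<zeta> q \<omega>)"
    and int: "integrable M (\<lambda>\<omega>. (norm (Z \<omega>))\<^sup>2)"
  shows "integrable M (\<lambda>\<omega>. (norm (cmp (\<zeta> (k, i, c) \<omega>) (Z \<omega>) /\<^sub>R r - Z \<omega>))\<^sup>2)"
    and "(\<integral>\<omega>. (norm (cmp (\<zeta> (k, i, c) \<omega>) (Z \<omega>) /\<^sub>R r - Z \<omega>))\<^sup>2 \<partial>M)
      \<le> (1 - \<psi>) * (\<integral>\<omega>. (norm (Z \<omega>))\<^sup>2 \<partial>M)"
proof -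
  interpret M: prob_space M by (rule M)
  define P :: "('n seed_index \<Rightarrow> 's) measure" where "P = PiM (past k) (\<lambda>_. S)"
  define R where "R \<omega> = (\<lambda>q\<in>past k. \<zeta> q \<omega>)" for \<omega>
  define e where "e s x = (norm (cmp s x /\<^sub>R r - x))\<^sup>2" for s x
  have \<zeta>: "\<zeta> p \<in> M \<rightarrow>\<^sub>M S" "distr M S (\<zeta> p) = S" for p
    using fresh unfolding fresh_seeds_def by blast+
  have R: "R \<in> M \<rightarrow>\<^sub>M P"
    unfolding R_def P_def by (intro measurable_restrict \<zeta>)
  have pair_R: "(\<lambda>\<omega>. (\<zeta> (k, i, c) \<omega>, R \<omega>)) \<in> M \<rightarrow>\<^sub>M S \<Otimes>\<^sub>M P"
    by (intro measurable_Pair \<zeta> R)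
  have Z_R: "Z \<omega> = g (R \<omega>)" for \<omega> by (simp add: Z R_def)
  have [measurable]: "g \<in> borel_measurable P" using g by (simp add: P_def)
  have cmp_m: "(\<lambda>(s, x). cmp s x) \<in> (S \<Otimes>\<^sub>M borel) \<rightarrow>\<^sub>M borel" and S: "prob_space S"
    using cmp by (auto simp: randomized_map_def)
  have pair: "(\<lambda>y. (fst y, g (snd y))) \<in> S \<Otimes>\<^sub>M P \<rightarrow>\<^sub>M S \<Otimes>\<^sub>M borel" by measurable
  have cmp_g [measurable]: "(\<lambda>y. cmp (fst y) (g (snd y))) \<in> borel_measurable (S \<Otimes>\<^sub>M P)"
    using measurable_compose[OF pair cmp_m] by simp
  have e_m: "(\<lambda>y. ennreal (e (fst y) (g (snd y)))) \<in> borel_measurable (S \<Otimes>\<^sub>M P)"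
    unfolding e_def by measurable
  interpret S: prob_space S by (rule S)
  interpret DR: prob_space "distr M P R" by (rule M.prob_space_distr[OF R])
  interpret pair_sigma_finite S "distr M P R" ..
  \<comment> \<open>Checked on rectangles, whose preimages lie in the two independent generated
    sigma-algebras.\<close>
  have distr_eq: "S \<Otimes>\<^sub>M distr M P R = distr M (S \<Otimes>\<^sub>M P) (\<lambda>\<omega>. (\<zeta> (k, i, c) \<omega>, R \<omega>))" (is "_ = ?J")
  proof (rule pair_measure_eqI)
    have sets_DR: "sets (distr M P R) = sets P" by simp
    then show "sets (S \<Otimes>\<^sub>M distr M P R) = sets ?J"
      by (simp cong: sets_pair_measure_cong)
    fix A B assume A: "A \<in> sets S" and "B \<in> sets (distr M P R)"
    then have B: "B \<in> sets P" by simp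
    have ind: "M.indep_set (sets (vimage_algebra (space M) (\<zeta> (k, i, c)) S)) (sets (vimage_algebra (space M) R P))"
      using fresh unfolding fresh_seeds_def P_def R_def[abs_def] by blast
    have "?J (A \<times> B) = emeasure M ((\<zeta> (k, i, c) -` A \<inter> space M) \<inter> (R -` B \<inter> space M))"
      using A B \<zeta> R by (subst emeasure_distr) (auto intro!: arg_cong[where f = "emeasure M"])
    also have "\<dots> = ennreal (M.prob (\<zeta> (k, i, c) -` A \<inter> space M) * M.prob (R -` B \<inter> space M))"
      unfolding M.emeasure_eq_measure
      by (subst M.indep_setD[OF ind]) (auto intro: in_vimage_algebra A B)
    also have "\<dots> = distr M S (\<zeta> (k, i, c)) A * distr M P R B"
      using A B \<zeta>(1) R by (simp add: emeasure_distr M.emeasure_eq_measure ennreal_mult')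
    finally show "S A * distr M P R B = ?J (A \<times> B)" by (simp add: \<zeta>(2))
  qed (intro S.sigma_finite_measure_axioms DR.sigma_finite_measure_axioms)+
  have inner: "(\<integral>\<^sup>+s. ennreal (e s x) \<partial>S) \<le> ennreal ((1 - \<psi>) * (norm x)\<^sup>2)" for x
  proof -
    have "integrable S (\<lambda>s. e s x)" "(\<integral>s. e s x \<partial>S) \<le> (1 - \<psi>) * (norm x)\<^sup>2"
      using comp by (auto simp: contractive_compressor_def e_def)
    then show ?thesis
      by (subst nn_integral_eq_integral) (auto simp: e_def intro!: ennreal_leI)
  qed
  have "(\<integral>\<^sup>+\<omega>. ennreal (e (\<zeta> (k, i, c) \<omega>) (Z \<omega>)) \<partial>M)
      = (\<integral>\<^sup>+y. ennreal (e (fst y) (g (snd y))) \<partial>(S \<Otimes>\<^sub>M distr M P R))"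
    unfolding distr_eq using e_m by (simp add: nn_integral_distr[OF pair_R] Z_R)
  also have "\<dots> = (\<integral>\<^sup>+x. \<integral>\<^sup>+s. ennreal (e s (g x)) \<partial>S \<partial>distr M P R)"
    using e_m by (subst nn_integral_snd[symmetric]) (auto simp: split_beta')
  also have "\<dots> \<le> (\<integral>\<^sup>+x. ennreal ((1 - \<psi>) * (norm (g x))\<^sup>2) \<partial>distr M P R)"
    by (intro nn_integral_mono inner)
  also have "\<dots> = (\<integral>\<^sup>+\<omega>. ennreal ((1 - \<psi>) * (norm (Z \<omega>))\<^sup>2) \<partial>M)"
    using R by (subst nn_integral_distr) (auto simp: Z_R)
  also have "\<dots> = ennreal ((1 - \<psi>) * (\<integral>\<omega>. (norm (Z \<omega>))\<^sup>2 \<partial>M))"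
    using int \<psi> by (subst nn_integral_eq_integral) auto
  finally have bound: "(\<integral>\<^sup>+\<omega>. ennreal (e (\<zeta> (k, i, c) \<omega>) (Z \<omega>)) \<partial>M)
      \<le> ennreal ((1 - \<psi>) * (\<integral>\<omega>. (norm (Z \<omega>))\<^sup>2 \<partial>M))" .
  have "(\<lambda>y. e (fst y) (g (snd y))) \<in> borel_measurable (S \<Otimes>\<^sub>M P)" unfolding e_def by measurable
  from measurable_compose[OF pair_R this]
  have meas: "(\<lambda>\<omega>. e (\<zeta> (k, i, c) \<omega>) (Z \<omega>)) \<in> borel_measurable M"
    by (simp add: Z_R)
  have e0: "0 \<le> e s x" for s x by (simp add: e_def)
  have integ: "integrable M (\<lambda>\<omega>. e (\<zeta> (k, i, c) \<omega>) (Z \<omega>))"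
    using meas bound e0 by (intro integrableI_bounded) (auto simp: le_less_trans)
  then show "integrable M (\<lambda>\<omega>. (norm (cmp (\<zeta> (k, i, c) \<omega>) (Z \<omega>) /\<^sub>R r - Z \<omega>))\<^sup>2)"
    by (simp add: e_def)
  have "ennreal (\<integral>\<omega>. e (\<zeta> (k, i, c) \<omega>) (Z \<omega>) \<partial>M) \<le> ennreal ((1 - \<psi>) * (\<integral>\<omega>. (norm (Z \<omega>))\<^sup>2 \<partial>M))"
    using bound integ e0 by (subst nn_integral_eq_integral[symmetric]) auto
  then show "(\<integral>\<omega>. (norm (cmp (\<zeta> (k, i, c) \<omega>) (Z \<omega>) /\<^sub>R r - Z \<omega>))\<^sup>2 \<partial>M)
      \<le> (1 - \<psi>) * (\<integral>\<omega>. (norm (Z \<omega>))\<^sup>2 \<partial>M)"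
    using \<psi> by (simp add: ennreal_le_iff e_def)
qed

text \<open>The squared norm is a sum over agents, so linearity of expectation suffices and seeds of
  the same time may be dependent.\<close>

lemma stacked_compression_error_expectation:
  fixes cmp :: "'s \<Rightarrow> real ^ 'd \<Rightarrow> real ^ 'd" and \<zeta> :: "'n::finite seed_index \<Rightarrow> 'w \<Rightarrow> 's"
    and Z :: "'w \<Rightarrow> real ^ 'd ^ 'n"
  assumes cmp: "randomized_map S cmp" and comp: "contractive_compressor S cmp r \<psi>" and \<psi>: "\<psi> \<le> 1"
    and M: "prob_space M" and fresh: "fresh_seeds M S \<zeta>"
    and g: "g \<in> borel_measurable (PiM (past k) (\<lambda>_. S))"
    and Z: "\<And>\<omega>. Z \<omega> = g (\<lambda>q\<in>past k. \<zeta> q \<omega>)"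
    and int: "integrable M (\<lambda>\<omega>. (norm (Z \<omega>))\<^sup>2)"
  shows "integrable M (\<lambda>\<omega>. (norm (compress cmp (\<lambda>i. \<zeta> (k, i, c) \<omega>) (Z \<omega>) /\<^sub>R r - Z \<omega>))\<^sup>2)"
    and "(\<integral>\<omega>. (norm (compress cmp (\<lambda>i. \<zeta> (k, i, c) \<omega>) (Z \<omega>) /\<^sub>R r - Z \<omega>))\<^sup>2 \<partial>M)
      \<le> (1 - \<psi>) * (\<integral>\<omega>. (norm (Z \<omega>))\<^sup>2 \<partial>M)"
proof -
  have \<zeta>: "\<zeta> p \<in> M \<rightarrow>\<^sub>M S" for p using fresh unfolding fresh_seeds_def by blast
  have Z_m: "Z \<in> borel_measurable M"
    unfolding Z[abs_def] by (intro measurable_compose[OF _ g] measurable_restrict \<zeta>)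
  have int_i: "integrable M (\<lambda>\<omega>. (norm (Z \<omega> $ i))\<^sup>2)" for i
    by (rule Bochner_Integration.integrable_bound[OF int])
      (use borel_measurable_vec_nth[OF Z_m] in \<open>auto simp: Finite_Cartesian_Product.norm_nth_le\<close>)
  note comp_i = compression_error_expectation[OF cmp comp \<psi> M fresh borel_measurable_vec_nth[OF g], of "\<lambda>\<omega>. Z \<omega> $ i" i i c for i,
      OF arg_cong[OF Z, of "\<lambda>x. x $ i" for i] int_i]
  have sq: "(norm (compress cmp (\<lambda>i. \<zeta> (k, i, c) \<omega>) (Z \<omega>) /\<^sub>R r - Z \<omega>))\<^sup>2
      = (\<Sum>i\<in>UNIV. (norm (cmp (\<zeta> (k, i, c) \<omega>) (Z \<omega> $ i) /\<^sub>R r - Z \<omega> $ i))\<^sup>2)" for \<omega>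
    by (simp add: norm_vec_sq compress_def)
  show "integrable M (\<lambda>\<omega>. (norm (compress cmp (\<lambda>i. \<zeta> (k, i, c) \<omega>) (Z \<omega>) /\<^sub>R r - Z \<omega>))\<^sup>2)"
    unfolding sq by (intro Bochner_Integration.integrable_sum comp_i(1))
  have "(\<integral>\<omega>. (norm (compress cmp (\<lambda>i. \<zeta> (k, i, c) \<omega>) (Z \<omega>) /\<^sub>R r - Z \<omega>))\<^sup>2 \<partial>M)
      = (\<Sum>i\<in>UNIV. \<integral>\<omega>. (norm (cmp (\<zeta> (k, i, c) \<omega>) (Z \<omega> $ i) /\<^sub>R r - Z \<omega> $ i))\<^sup>2 \<partial>M)"
    unfolding sq by (intro Bochner_Integration.integral_sum comp_i(1))
  also have "\<dots> \<le> (\<Sum>i\<in>UNIV. (1 - \<psi>) * (\<integral>\<omega>. (norm (Z \<omega> $ i))\<^sup>2 \<partial>M))"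
    by (intro sum_mono comp_i(2))
  also have "\<dots> = (1 - \<psi>) * (\<integral>\<omega>. (norm (Z \<omega>))\<^sup>2 \<partial>M)"
    by (simp add: norm_vec_sq[of "Z _"] Bochner_Integration.integral_sum int_i sum_distrib_left)
  finally show "(\<integral>\<omega>. (norm (compress cmp (\<lambda>i. \<zeta> (k, i, c) \<omega>) (Z \<omega>) /\<^sub>R r - Z \<omega>))\<^sup>2 \<partial>M)
      \<le> (1 - \<psi>) * (\<integral>\<omega>. (norm (Z \<omega>))\<^sup>2 \<partial>M)" .
qed

subsection \<open>Expected contraction\<close>

text \<open>The start \<open>A = C = 0\<close> makes the initial messages compressions of
  \<open>X - A\<close> and \<open>Y - C\<close>. Tracking persists because residuals average to zero
  and the gradient differences telescope.\<close>

lemma alg_run_invariants: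
  fixes W :: "real ^ 'n ^ 'n" and F :: "'n::finite \<Rightarrow> real ^ 'd \<Rightarrow> real"
    and cmp :: "'s \<Rightarrow> real ^ 'd \<Rightarrow> real ^ 'd" and X0 :: "real ^ 'd ^ 'n"
    and z :: "'n seed_index \<Rightarrow> 's" and \<gamma> \<eta> \<phi>\<^sub>X \<phi>\<^sub>Y :: real
  assumes W: "doubly_stochastic_weights E W"
  defines "s \<equiv> alg_run cmp W F \<gamma> \<eta> \<phi>\<^sub>X \<phi>\<^sub>Y X0 z"
  shows "stB (s k) = mix_residual W (stA (s k))" "stD (s k) = mix_residual W (stC (s k))"
    "avg (stY (s k)) = avg (stacked_grad F (stX (s k)))"
    "stQX (s k) = compress cmp (\<lambda>i. z (k, i, XChan)) (stX (s k) - stA (s k))"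
    "stQY (s k) = compress cmp (\<lambda>i. z (k, i, YChan)) (stY (s k) - stC (s k))"
proof -
  have "stB (s k) = mix_residual W (stA (s k)) \<and> stD (s k) = mix_residual W (stC (s k)) \<and>
    avg (stY (s k)) = avg (stacked_grad F (stX (s k))) \<and>
    stQX (s k) = compress cmp (\<lambda>i. z (k, i, XChan)) (stX (s k) - stA (s k)) \<and>
    stQY (s k) = compress cmp (\<lambda>i. z (k, i, YChan)) (stY (s k) - stC (s k))"
  proof (induction k)
    case 0
    then show ?case by (simp add: s_def alg_init_def linear_0[OF linear_mix_residual])
  next
    case (Suc k)
    then show ?case
      by (simp add: s_def alg_step_def Let_def linear_add[OF linear_mix_residual]
          linear_cmul[OF linear_mix_residual] linear_add[OF linear_avg] linear_diff[OF linear_avg]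
          linear_cmul[OF linear_avg] avg_mix_residual[OF W])
  qed
  then show "stB (s k) = mix_residual W (stA (s k))" "stD (s k) = mix_residual W (stC (s k))"
    "avg (stY (s k)) = avg (stacked_grad F (stX (s k)))"
    "stQX (s k) = compress cmp (\<lambda>i. z (k, i, XChan)) (stX (s k) - stA (s k))"
    "stQY (s k) = compress cmp (\<lambda>i. z (k, i, YChan)) (stY (s k) - stC (s k))" by auto
qed

lemma continuous_on_linear_comp:
  fixes T :: "'a::euclidean_space \<Rightarrow> 'b::euclidean_space"
  assumes "linear T" "continuous_on S f"
  shows "continuous_on S (\<lambda>x. T (f x))"
  using continuous_on_compose[OF assms(2) linear_continuous_on[of T]] assms(1)
  by (simp add: linear_conv_bounded_linear o_def)

context compressed_tracking
begin

lemma continuous_on_optimality_gap: "continuous_on UNIV (optimality_gap F)"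
proof -
  have "continuous_on UNIV (F i)" for i
    using F_diff by (intro differentiable_imp_continuous_on) (simp add: differentiable_on_def)
  then have "continuous_on UNIV (mean_cost F)"
    unfolding mean_cost_def[abs_def] by (intro continuous_intros)
  from continuous_on_compose2[OF this continuous_on_linear_comp[OF linear_avg continuous_on_id]]
  show ?thesis unfolding optimality_gap_def[abs_def] by (intro continuous_intros) auto
qed

text \<open>Stated on quadruples, so that composition with \<open>pre_state\<close> gives
  measurability along the run.\<close>

lemma continuous_on_lyapunov:
  "continuous_on UNIV (\<lambda>(X, Y, A, Z). lyapunov X Y A Z)"
  "continuous_on UNIV (\<lambda>(X :: real ^ 'd ^ 'n, Y :: real ^ 'd ^ 'n, A :: real ^ 'd ^ 'n, Z :: real ^ 'd ^ 'n).
    (norm (X - rep_avg X))\<^sup>2 + optimality_gap F X)"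
  unfolding lyapunov_def split_beta'
  by (intro continuous_intros continuous_on_linear_comp[OF linear_rep_avg]
      continuous_on_compose2[OF continuous_on_optimality_gap] subset_UNIV)+

text \<open>Integrability at time \<open>k\<close> gives square-integrable compression errors, as
  required for the expected excess; so it has to be passed on together with the bound.\<close>

lemma expectation_step:
  fixes cmp :: "'s \<Rightarrow> real ^ 'd \<Rightarrow> real ^ 'd" and \<zeta> :: "'n seed_index \<Rightarrow> 'w \<Rightarrow> 's"
    and X0 :: "real ^ 'd ^ 'n"
  assumes cmp: "randomized_map S cmp" "contractive_compressor S cmp r \<psi>"
    and M: "prob_space M" and fresh: "fresh_seeds M S \<zeta>"
  defines "p \<equiv> \<lambda>k \<omega>. pre_state (alg_run cmp W F \<gamma> \<eta> \<phi>\<^sub>X \<phi>\<^sub>Y X0 (\<lambda>q. \<zeta> q \<omega>) k)"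
  defines "U \<equiv> \<lambda>k \<omega>. case p k \<omega> of (X, Y, A, Z) \<Rightarrow> lyapunov X Y A Z"
  assumes int: "integrable M (U k)"
  shows "integrable M (U (Suc k))" "(\<integral>\<omega>. U (Suc k) \<omega> \<partial>M) \<le> (1 - \<theta>) * (\<integral>\<omega>. U k \<omega> \<partial>M)"
proof -
  define st where "st j \<omega> = alg_run cmp W F \<gamma> \<eta> \<phi>\<^sub>X \<phi>\<^sub>Y X0 (\<lambda>q. \<zeta> q \<omega>) j" for j \<omega>
  define e\<^sub>X where "e\<^sub>X \<omega> = stX (st k \<omega>) - stA (st k \<omega>)" for \<omega>
  define e\<^sub>Y where "e\<^sub>Y \<omega> = stY (st k \<omega>) - stC (st k \<omega>)" for \<omega>
  define q\<^sub>X where "q\<^sub>X \<omega> = (norm (stQX (st k \<omega>) /\<^sub>R r - e\<^sub>X \<omega>))\<^sup>2" for \<omega>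
  define q\<^sub>Y where "q\<^sub>Y \<omega> = (norm (stQY (st k \<omega>) /\<^sub>R r - e\<^sub>Y \<omega>))\<^sup>2" for \<omega>
  have \<zeta>: "\<zeta> q \<in> M \<rightarrow>\<^sub>M S" for q using fresh unfolding fresh_seeds_def by blast
  have L0: "0 \<le> L" using L by simp
  have p_meas: "p j \<in> borel_measurable M" for j
    unfolding p_def using \<zeta> by (intro borel_measurable_pre_state[OF cmp(1) L0 L(2)]) auto
  have U_meas: "U j \<in> borel_measurable M" for j
    unfolding U_def by (rule borel_measurable_continuous_on[OF continuous_on_lyapunov(1) p_meas])
  have U_st: "U j \<omega> = lyapunov (stX (st j \<omega>)) (stY (st j \<omega>)) (stA (st j \<omega>)) (stC (st j \<omega>))" for j \<omega>
    by (simp add: U_def p_def pre_state_def st_def)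
  define g\<^sub>X where "g\<^sub>X z = (case pre_state (alg_run cmp W F \<gamma> \<eta> \<phi>\<^sub>X \<phi>\<^sub>Y X0 z k) of (X, Y, A, Z) \<Rightarrow> X - A)" for z
  define g\<^sub>Y where "g\<^sub>Y z = (case pre_state (alg_run cmp W F \<gamma> \<eta> \<phi>\<^sub>X \<phi>\<^sub>Y X0 z k) of (X, Y, A, Z) \<Rightarrow> Y - Z)" for z
  \<comment> \<open>The coordinates of the product space themselves play the role of the
    seeds.\<close>
  have pre_PiM: "(\<lambda>z. pre_state (alg_run cmp W F \<gamma> \<eta> \<phi>\<^sub>X \<phi>\<^sub>Y X0 z k)) \<in> borel_measurable (PiM (past k) (\<lambda>_. S))"
    by (rule borel_measurable_pre_state[OF cmp(1) L0 L(2), where \<zeta> = "\<lambda>q z. z q"])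
      (rule measurable_component_singleton)
  have g_meas: "g\<^sub>X \<in> borel_measurable (PiM (past k) (\<lambda>_. S))" "g\<^sub>Y \<in> borel_measurable (PiM (past k) (\<lambda>_. S))"
    unfolding g\<^sub>X_def g\<^sub>Y_def split_beta'
    by (rule borel_measurable_continuous_on[OF _ pre_PiM]; intro continuous_intros)+
  \<comment> \<open>The restricted family is \<open>undefined\<close> outside \<open>past k\<close>,
    where \<open>pre_state\<close> does not look.\<close>
  have restr: "pre_state (alg_run cmp W F \<gamma> \<eta> \<phi>\<^sub>X \<phi>\<^sub>Y X0 (\<lambda>q\<in>past k. \<zeta> q \<omega>) k) = pre_state (st k \<omega>)" for \<omega>
    unfolding st_def by (intro pre_state_alg_run_cong) simp
  have e_g: "e\<^sub>X \<omega> = g\<^sub>X (\<lambda>q\<in>past k. \<zeta> q \<omega>)" "e\<^sub>Y \<omega> = g\<^sub>Y (\<lambda>q\<in>past k. \<zeta> q \<omega>)" for \<omega>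
    by (simp_all add: g\<^sub>X_def g\<^sub>Y_def restr, simp_all add: pre_state_def e\<^sub>X_def e\<^sub>Y_def)
  have restr_meas: "(\<lambda>\<omega>. \<lambda>q\<in>past k. \<zeta> q \<omega>) \<in> M \<rightarrow>\<^sub>M PiM (past k) (\<lambda>_. S)"
    by (intro measurable_restrict \<zeta>)
  have e_meas: "e\<^sub>X \<in> borel_measurable M" "e\<^sub>Y \<in> borel_measurable M"
    unfolding e_g[abs_def] by (intro measurable_compose[OF restr_meas] g_meas)+
  have int_e: "integrable M (\<lambda>\<omega>. (norm (e\<^sub>X \<omega>))\<^sup>2)" "integrable M (\<lambda>\<omega>. (norm (e\<^sub>Y \<omega>))\<^sup>2)"
  proof -
    show "integrable M (\<lambda>\<omega>. (norm (e\<^sub>X \<omega>))\<^sup>2)"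
    proof (rule Bochner_Integration.integrable_bound[OF int])
      have "norm ((norm (e\<^sub>X \<omega>))\<^sup>2) \<le> norm (U k \<omega>)" for \<omega>
        using compression_errors_le_lyapunov(1)[of "stX (st k \<omega>)" "stA (st k \<omega>)" "stY (st k \<omega>)" "stC (st k \<omega>)"]
        by (simp add: U_st e\<^sub>X_def)
      then show "AE \<omega> in M. norm ((norm (e\<^sub>X \<omega>))\<^sup>2) \<le> norm (U k \<omega>)" by simp
    qed (use e_meas in measurable)
    show "integrable M (\<lambda>\<omega>. (norm (e\<^sub>Y \<omega>))\<^sup>2)"
    proof (rule Bochner_Integration.integrable_bound)
      show "integrable M (\<lambda>\<omega>. U k \<omega> / (1 - \<sigma>))" using int by simp
      have "norm ((norm (e\<^sub>Y \<omega>))\<^sup>2) \<le> norm (U k \<omega> / (1 - \<sigma>))" for \<omega>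
        using compression_errors_le_lyapunov(2)[of "stY (st k \<omega>)" "stC (st k \<omega>)" "stX (st k \<omega>)" "stA (st k \<omega>)"]
        by (simp add: U_st e\<^sub>Y_def del: abs_divide)
      then show "AE \<omega> in M. norm ((norm (e\<^sub>Y \<omega>))\<^sup>2) \<le> norm (U k \<omega> / (1 - \<sigma>))" by simp
    qed (use e_meas in measurable)
  qed
  note inv = alg_run_invariants[OF W, of cmp F \<gamma> \<eta> \<phi>\<^sub>X \<phi>\<^sub>Y X0 "\<lambda>q. \<zeta> q _" k, folded st_def]
  have q_eq: "q\<^sub>X \<omega> = (norm (compress cmp (\<lambda>i. \<zeta> (k, i, XChan) \<omega>) (e\<^sub>X \<omega>) /\<^sub>R r - e\<^sub>X \<omega>))\<^sup>2"
    "q\<^sub>Y \<omega> = (norm (compress cmp (\<lambda>i. \<zeta> (k, i, YChan) \<omega>) (e\<^sub>Y \<omega>) /\<^sub>R r - e\<^sub>Y \<omega>))\<^sup>2" for \<omega>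
    using inv(4,5)[of \<omega>] by (simp_all add: q\<^sub>X_def q\<^sub>Y_def e\<^sub>X_def e\<^sub>Y_def)
  note noise_X = stacked_compression_error_expectation[OF cmp \<psi>(2) M fresh g_meas(1) e_g(1) int_e(1),
      of XChan, folded q_eq(1)]
  note noise_Y = stacked_compression_error_expectation[OF cmp \<psi>(2) M fresh g_meas(2) e_g(2) int_e(2),
      of YChan, folded q_eq(2)]
  define B where "B \<omega> = (1 - \<theta>) * U k \<omega> + noise_weight_X * (q\<^sub>X \<omega> - (1 - \<psi>) * (norm (e\<^sub>X \<omega>))\<^sup>2)
    + noise_weight_Y * (q\<^sub>Y \<omega> - (1 - \<psi>) * (norm (e\<^sub>Y \<omega>))\<^sup>2)" for \<omega>
  have step: "U (Suc k) \<omega> \<le> B \<omega>" for \<omega>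
  proof -
    have "st (Suc k) \<omega> = alg_step cmp W F \<gamma> \<eta> \<phi>\<^sub>X \<phi>\<^sub>Y (\<lambda>i. \<zeta> (Suc k, i, XChan) \<omega>)
        (\<lambda>i. \<zeta> (Suc k, i, YChan) \<omega>) (st k \<omega>)"
      by (simp add: st_def)
    then show ?thesis
      using lyapunov_step[OF inv(3)[of \<omega>] refl refl, of "stA (st k \<omega>)" "stQX (st k \<omega>)" "stC (st k \<omega>)" "stQY (st k \<omega>)"]
      by (simp add: U_st B_def q\<^sub>X_def q\<^sub>Y_def e\<^sub>X_def e\<^sub>Y_def alg_step_def Let_def inv(1,2)[of \<omega>])
  qed
  have int_B: "integrable M B"
    unfolding B_def[abs_def] using int noise_X(1) noise_Y(1) int_e by (intro Bochner_Integration.integrable_add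
        Bochner_Integration.integrable_diff integrable_mult_right)
  \<comment> \<open>Nonnegativity turns the upper bound \<open>B\<close> into domination in absolute
    value.\<close>
  have "0 \<le> U (Suc k) \<omega>" for \<omega> by (simp add: U_st lyapunov_nonneg)
  then have "norm (U (Suc k) \<omega>) \<le> norm (B \<omega>)" for \<omega>
    using step[of \<omega>] by (smt (verit) real_norm_def)
  then show int': "integrable M (U (Suc k))"
    by (intro Bochner_Integration.integrable_bound[OF int_B U_meas]) simp
  have "(\<integral>\<omega>. U (Suc k) \<omega> \<partial>M) \<le> (\<integral>\<omega>. B \<omega> \<partial>M)"
    by (intro integral_mono int' int_B step)
  also have "\<dots> = (1 - \<theta>) * (\<integral>\<omega>. U k \<omega> \<partial>M)
      + noise_weight_X * ((\<integral>\<omega>. q\<^sub>X \<omega> \<partial>M) - (1 - \<psi>) * (\<integral>\<omega>. (norm (e\<^sub>X \<omega>))\<^sup>2 \<partial>M))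
      + noise_weight_Y * ((\<integral>\<omega>. q\<^sub>Y \<omega> \<partial>M) - (1 - \<psi>) * (\<integral>\<omega>. (norm (e\<^sub>Y \<omega>))\<^sup>2 \<partial>M))"
    unfolding B_def[abs_def] using int noise_X(1) noise_Y(1) int_e by simp
  also have "\<dots> \<le> (1 - \<theta>) * (\<integral>\<omega>. U k \<omega> \<partial>M)"
    using mult_nonneg_nonpos[OF noise_weights_nonneg(1), of "(\<integral>\<omega>. q\<^sub>X \<omega> \<partial>M) - (1 - \<psi>) * (\<integral>\<omega>. (norm (e\<^sub>X \<omega>))\<^sup>2 \<partial>M)"]
      mult_nonneg_nonpos[OF noise_weights_nonneg(2), of "(\<integral>\<omega>. q\<^sub>Y \<omega> \<partial>M) - (1 - \<psi>) * (\<integral>\<omega>. (norm (e\<^sub>Y \<omega>))\<^sup>2 \<partial>M)"]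
      noise_X(2) noise_Y(2) by simp
  finally show "(\<integral>\<omega>. U (Suc k) \<omega> \<partial>M) \<le> (1 - \<theta>) * (\<integral>\<omega>. U k \<omega> \<partial>M)" .
qed

lemma expected_gap_bound:
  fixes cmp :: "'s \<Rightarrow> real ^ 'd \<Rightarrow> real ^ 'd" and \<zeta> :: "'n seed_index \<Rightarrow> 'w \<Rightarrow> 's"
    and X0 :: "real ^ 'd ^ 'n"
  assumes cmp: "randomized_map S cmp" "contractive_compressor S cmp r \<psi>"
    and M: "prob_space M" and fresh: "fresh_seeds M S \<zeta>"
  defines "X \<equiv> \<lambda>k \<omega>. stX (alg_run cmp W F \<gamma> \<eta> \<phi>\<^sub>X \<phi>\<^sub>Y X0 (\<lambda>q. \<zeta> q \<omega>) k)"
  shows "integrable M (\<lambda>\<omega>. (norm (X k \<omega> - rep_avg (X k \<omega>)))\<^sup>2 + optimality_gap F (X k \<omega>))"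
    and "(\<integral>\<omega>. (norm (X k \<omega> - rep_avg (X k \<omega>)))\<^sup>2 + optimality_gap F (X k \<omega>) \<partial>M)
      \<le> (1 - \<theta>) ^ k * U_fun F \<phi> X0 (stacked_grad F X0) 0 0"
proof -
  interpret M: prob_space M by (rule M)
  define p where "p k \<omega> = pre_state (alg_run cmp W F \<gamma> \<eta> \<phi>\<^sub>X \<phi>\<^sub>Y X0 (\<lambda>q. \<zeta> q \<omega>) k)" for k \<omega>
  define U where "U k \<omega> = (case p k \<omega> of (X, Y, A, Z) \<Rightarrow> lyapunov X Y A Z)" for k \<omega>
  define G where "G k \<omega> = (norm (X k \<omega> - rep_avg (X k \<omega>)))\<^sup>2 + optimality_gap F (X k \<omega>)" for k \<omega>
  have U: "integrable M (U k) \<and> (\<integral>\<omega>. U k \<omega> \<partial>M) \<le> (1 - \<theta>) ^ k * U_fun F \<phi> X0 (stacked_grad F X0) 0 0" for k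
  proof (induction k)
    case 0
    \<comment> \<open>The seeds of time 0 affect only the messages, so \<open>U 0\<close> is
      constant.\<close>
    have "U 0 = (\<lambda>\<omega>. lyapunov X0 (stacked_grad F X0) 0 0)"
      by (simp add: U_def[abs_def] p_def pre_state_def alg_init_def)
    then show ?case by (simp add: lyapunov_le_U_fun M.prob_space)
  next
    case (Suc k)
    note step = expectation_step[OF cmp M fresh, of X0 k, folded p_def U_def]
    have "(\<integral>\<omega>. U (Suc k) \<omega> \<partial>M) \<le> (1 - \<theta>) * (\<integral>\<omega>. U k \<omega> \<partial>M)" using Suc step(2) by blast
    also have "\<dots> \<le> (1 - \<theta>) * ((1 - \<theta>) ^ k * U_fun F \<phi> X0 (stacked_grad F X0) 0 0)"
      using Suc \<theta>_le_1 by (intro mult_left_mono) auto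
    finally show ?case using Suc step(1) by simp
  qed
  have G_le: "G k \<omega> \<le> U k \<omega>" and G_nonneg: "0 \<le> G k \<omega>" for \<omega>
    using optimality_gap_nonneg[OF F_argmin]
    by (simp_all add: U_def p_def pre_state_def G_def X_def gap_le_lyapunov)
  have "\<zeta> q \<in> M \<rightarrow>\<^sub>M S" for q using fresh unfolding fresh_seeds_def by blast
  then have "p k \<in> borel_measurable M"
    unfolding p_def[abs_def] using L by (intro borel_measurable_pre_state[OF cmp(1) _ L(2)]) auto
  from borel_measurable_continuous_on[OF continuous_on_lyapunov(2) this]
  have "G k \<in> borel_measurable M" by (simp add: G_def[abs_def] p_def pre_state_def X_def)
  moreover have "norm (G k \<omega>) \<le> norm (U k \<omega>)" for \<omega>
    using G_le[of \<omega>] G_nonneg[of \<omega>] by simp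
  ultimately have int: "integrable M (G k)"
    using U[of k] by (intro Bochner_Integration.integrable_bound[of M "U k" "G k"]) auto
  then show "integrable M (\<lambda>\<omega>. (norm (X k \<omega> - rep_avg (X k \<omega>)))\<^sup>2 + optimality_gap F (X k \<omega>))"
    by (simp add: G_def[abs_def])
  have "(\<integral>\<omega>. G k \<omega> \<partial>M) \<le> (\<integral>\<omega>. U k \<omega> \<partial>M)"
    using U by (intro integral_mono int G_le) auto
  with U[of k] show "(\<integral>\<omega>. (norm (X k \<omega> - rep_avg (X k \<omega>)))\<^sup>2 + optimality_gap F (X k \<omega>) \<partial>M)
      \<le> (1 - \<theta>) ^ k * U_fun F \<phi> X0 (stacked_grad F X0) 0 0"
    by (simp add: G_def)
qed

end

section \<open>Step sizes and the final rate\<close>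

lemma gamma_bound_imp:
  fixes \<sigma> L c\<^sub>1 c\<^sub>2 C \<gamma> :: real
  assumes "ereal \<gamma> < gamma_bound \<sigma> L c\<^sub>1 c\<^sub>2 C" "0 < \<gamma>" "0 < c\<^sub>1" "0 < c\<^sub>2" "0 < L" "0 \<le> C" "\<sigma> < 1"
  shows "\<gamma> * (1 + inverse c\<^sub>1) \<le> (1 - \<sigma>) / 160" "\<gamma> * (1 + inverse c\<^sub>2) * L\<^sup>2 \<le> (1 - \<sigma>) / 40000"
    "\<gamma> * C \<le> c\<^sub>1 * (1 - \<sigma>) / 40" "\<gamma> * C \<le> c\<^sub>2 * L\<^sup>2" "\<gamma>\<^sup>2 * C \<le> c\<^sub>2\<^sup>2 / 100"
proof -
  have i: "0 < 1 + inverse c\<^sub>1" "0 < 1 + inverse c\<^sub>2" using assms by (simp_all add: add_pos_pos)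
  have b: "ereal \<gamma> < ereal ((1 - \<sigma>) / (160 * (1 + inverse c\<^sub>1)))"
    "ereal \<gamma> < ereal ((1 - \<sigma>) / (40000 * (1 + inverse c\<^sub>2) * L\<^sup>2))"
    "ereal \<gamma> < ereal (c\<^sub>1 * (1 - \<sigma>)) / ereal (40 * C)" "ereal \<gamma> < ereal (c\<^sub>2 * L\<^sup>2) / ereal C"
    "ereal \<gamma> < ereal c\<^sub>2 / ereal (10 * sqrt C)"
    using assms(1) unfolding gamma_bound_def
    by (simp_all only: Min_gr_iff finite_insert finite.emptyI insert_not_empty not_False_eq_True) blast+
  show "\<gamma> * (1 + inverse c\<^sub>1) \<le> (1 - \<sigma>) / 160"
    using b(1) i by (simp add: pos_less_divide_eq mult_ac)
  have "0 < 40000 * (1 + inverse c\<^sub>2) * L\<^sup>2" using i assms by simp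
  then have "\<gamma> * (40000 * (1 + inverse c\<^sub>2) * L\<^sup>2) < 1 - \<sigma>"
    using b(2) by (simp only: less_ereal.simps pos_less_divide_eq)
  moreover define v where "v = \<gamma> * (1 + inverse c\<^sub>2) * L\<^sup>2"
  have "\<gamma> * (40000 * (1 + inverse c\<^sub>2) * L\<^sup>2) = 40000 * v"
    by (simp only: v_def mult_ac)
  ultimately show "\<gamma> * (1 + inverse c\<^sub>2) * L\<^sup>2 \<le> (1 - \<sigma>) / 40000"
    unfolding v_def[symmetric] by simp
  \<comment> \<open>For \<open>y = 0\<close> the product form reads \<open>0 \<le> x\<close>, so the
    degenerate case \<open>C = 0\<close> needs no treatment elsewhere.\<close>
  have quot: "\<gamma> * y \<le> x" if "ereal \<gamma> < ereal x / ereal y" "0 \<le> x" "0 \<le> y" for x y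
    using that by (cases "y = 0") (auto simp: pos_less_divide_eq)
  show "\<gamma> * C \<le> c\<^sub>1 * (1 - \<sigma>) / 40" "\<gamma> * C \<le> c\<^sub>2 * L\<^sup>2"
    using quot[OF b(3)] quot[OF b(4)] assms by simp_all
  have "\<gamma> * (10 * sqrt C) \<le> c\<^sub>2" using quot[OF b(5)] assms by simp
  then have "(\<gamma> * (10 * sqrt C))\<^sup>2 \<le> c\<^sub>2\<^sup>2" using assms by (intro power_mono) auto
  then show "\<gamma>\<^sup>2 * C \<le> c\<^sub>2\<^sup>2 / 100" using assms by (simp add: power_mult_distrib)
qed

lemma eta_bound_imp:
  fixes \<sigma> L c\<^sub>1 c\<^sub>2 \<gamma> \<eta> :: real
  assumes "\<eta> < eta_bound \<sigma> L c\<^sub>1 c\<^sub>2 \<gamma>" "0 < L"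
  shows "\<eta> * L \<le> (1 - \<sigma>)\<^sup>2 * \<gamma> / 40" "\<eta> * L\<^sup>2 \<le> (4 / 10) * (1 - \<sigma>) * \<gamma>" "\<eta> \<le> \<gamma>" "\<eta> \<le> 1 / (2 * L)"
proof -
  have b: "\<eta> < (1 - \<sigma>)\<^sup>2 * \<gamma> / (40 * L)" "\<eta> < 0.4 * (1 - \<sigma>) * \<gamma> / L\<^sup>2" "\<eta> < 1 / (2 * L)" "\<eta> < \<gamma>"
    using assms(1) unfolding eta_bound_def
    by (simp_all only: Min_gr_iff finite_insert finite.emptyI insert_not_empty not_False_eq_True) blast+
  show "\<eta> * L \<le> (1 - \<sigma>)\<^sup>2 * \<gamma> / 40"
    using b(1) assms(2) by (simp add: pos_less_divide_eq mult_ac)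
  show "\<eta> * L\<^sup>2 \<le> (4 / 10) * (1 - \<sigma>) * \<gamma>"
    using b(2) assms(2) by (simp add: pos_less_divide_eq mult_ac)
  show "\<eta> \<le> \<gamma>" "\<eta> \<le> 1 / (2 * L)" using b by simp_all
qed

theorem theorem2:
  fixes E :: "('n::finite \<times> 'n) set"
    and W :: "real ^ 'n ^ 'n"
    and F :: "'n \<Rightarrow> real ^ 'd \<Rightarrow> real"
    and S :: "'s measure"
    and cmp :: "'s \<Rightarrow> real ^ 'd \<Rightarrow> real ^ 'd"
    and M :: "'w measure"
    and \<zeta> :: "'n seed_index \<Rightarrow> 'w \<Rightarrow> 's"
    and X :: "nat \<Rightarrow> 'w \<Rightarrow> real ^ 'd ^ 'n"
    and X0 :: "real ^ 'd ^ 'n"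
    and \<sigma> L\<^sub>f \<nu> r \<psi> \<phi>\<^sub>X \<phi>\<^sub>Y \<gamma> \<eta> c\<^sub>1 c\<^sub>2 C \<phi> :: real
    and \<epsilon>\<^sub>1 \<epsilon>\<^sub>2 \<epsilon>\<^sub>3 \<theta>\<^sub>2 \<theta>\<^sub>3 \<theta>\<^sub>4 :: real
  assumes "strongly_connected E"
    and "doubly_stochastic_weights E W"
    and "\<sigma> = spectral_norm (W - (\<chi> i j. 1 / real CARD('n)))"
    and "0 < \<sigma>" and "\<sigma> < 1"
    and "\<And>i x. F i differentiable (at x)"
    and "argmin (mean_cost F) \<noteq> {}"
    and "0 < L\<^sub>f"
    and "\<And>i x y. norm (grad (F i) x - grad (F i) y) \<le> L\<^sub>f * norm (x - y)"
    and "0 < \<nu>"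
    and "PL_condition (mean_cost F) \<nu>"
    and "randomized_map S cmp"
    and "0 < r" and "0 < \<psi>" and "\<psi> \<le> 1"
    and "contractive_compressor S cmp r \<psi>"
    and "prob_space M"
    and "fresh_seeds M S \<zeta>"
    and "0 < \<phi>\<^sub>X" and "\<phi>\<^sub>X < 1 / r"
    and "0 < \<phi>\<^sub>Y" and "\<phi>\<^sub>Y < 1 / r"
    and "c\<^sub>1 = \<phi>\<^sub>X * \<psi> * r / 2"
    and "c\<^sub>2 = \<phi>\<^sub>Y * \<psi> * r / 2"
    and "C = 2 * r\<^sup>2 * (1 - \<psi>) + 2 * (1 - r)\<^sup>2"
    and "0 < \<gamma>" and "ereal \<gamma> < gamma_bound \<sigma> L\<^sub>f c\<^sub>1 c\<^sub>2 C"
    and "0 < \<eta>" and "\<eta> < eta_bound \<sigma> L\<^sub>f c\<^sub>1 c\<^sub>2 \<gamma>"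
    and "\<phi> = (1 - \<sigma>)\<^sup>2 / (320 * L\<^sub>f\<^sup>2)"
    and "\<epsilon>\<^sub>1 = 8 * L\<^sub>f\<^sup>2 / ((1 - \<sigma>) * \<gamma>) * \<eta>\<^sup>2"
    and "\<epsilon>\<^sub>2 = 4 * (1 + inverse c\<^sub>1) * \<eta>\<^sup>2"
    and "\<epsilon>\<^sub>3 = 5 * (1 + inverse c\<^sub>2) * \<eta>\<^sup>2"
    and "\<theta>\<^sub>2 = \<eta> / 4 - (\<phi> * \<epsilon>\<^sub>1 + \<epsilon>\<^sub>2 + \<epsilon>\<^sub>3)"
    and "\<theta>\<^sub>3 = Min {0.07 * (1 - \<sigma>) * \<gamma>, 0.44 * c\<^sub>1 * (2 * c\<^sub>1 + 1), 0.77 * c\<^sub>2 * (2 * c\<^sub>2 + 1)}"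
    and "\<theta>\<^sub>4 = min \<theta>\<^sub>3 (2 * \<nu> * \<theta>\<^sub>2)"
    and "X = (\<lambda>k \<omega>. stX (alg_run cmp W F \<gamma> \<eta> \<phi>\<^sub>X \<phi>\<^sub>Y X0 (\<lambda>p. \<zeta> p \<omega>) k))"
  shows "\<forall>k. integrable M (\<lambda>\<omega>. (norm (X k \<omega> - rep_avg (X k \<omega>)))\<^sup>2 + optimality_gap F (X k \<omega>)) \<and>
             prob_space.expectation M
               (\<lambda>\<omega>. (norm (X k \<omega> - rep_avg (X k \<omega>)))\<^sup>2 + optimality_gap F (X k \<omega>))
             \<le> (1 - \<theta>\<^sub>4) ^ k * U_fun F \<phi> X0 (stacked_grad F X0) 0 0"
proof -
  have c_pos: "0 < c\<^sub>1" "0 < c\<^sub>2" and C: "0 \<le> C"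
    using \<open>0 < \<phi>\<^sub>X\<close> \<open>0 < \<phi>\<^sub>Y\<close> \<open>0 < r\<close> \<open>0 < \<psi>\<close> \<open>\<psi> \<le> 1\<close>
    by (simp_all add: \<open>c\<^sub>1 = _\<close> \<open>c\<^sub>2 = _\<close> \<open>C = _\<close>)
  note \<gamma>_bounds = gamma_bound_imp[OF \<open>ereal \<gamma> < _\<close> \<open>0 < \<gamma>\<close> c_pos \<open>0 < L\<^sub>f\<close> C \<open>\<sigma> < 1\<close>]
  note \<eta>_bounds = eta_bound_imp[OF \<open>\<eta> < _\<close> \<open>0 < L\<^sub>f\<close>]
  \<comment> \<open>The three corrections are nonnegative. Hence
    \<open>2 * \<nu> * \<theta>\<^sub>2\<close> is at most half of the rate
    \<open>\<nu> * \<eta>\<close> that the descent estimate provides.\<close>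
  have "\<theta>\<^sub>2 \<le> \<eta> / 4"
  proof -
    have "0 \<le> \<phi> * \<epsilon>\<^sub>1" "0 \<le> \<epsilon>\<^sub>2" "0 \<le> \<epsilon>\<^sub>3"
      using c_pos \<open>0 < \<gamma>\<close> \<open>\<sigma> < 1\<close> by (simp_all add: \<open>\<phi> = _\<close> \<open>\<epsilon>\<^sub>1 = _\<close> \<open>\<epsilon>\<^sub>2 = _\<close> \<open>\<epsilon>\<^sub>3 = _\<close>)
    then show ?thesis by (simp add: \<open>\<theta>\<^sub>2 = _\<close>)
  qed
  then have "2 * \<nu> * \<theta>\<^sub>2 \<le> 2 * \<nu> * (\<eta> / 4)" using \<open>0 < \<nu>\<close> by (intro mult_left_mono) auto
  also have "\<dots> \<le> \<nu> * \<eta>" using \<open>0 < \<nu>\<close> \<open>0 < \<eta>\<close> by simp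
  finally have \<theta>_\<nu>: "\<theta>\<^sub>4 \<le> \<nu> * \<eta>" by (simp add: \<open>\<theta>\<^sub>4 = _\<close>)
  have \<theta>_bounds: "\<theta>\<^sub>4 \<le> (7 / 100) * (1 - \<sigma>) * \<gamma>" "\<theta>\<^sub>4 \<le> (44 / 100) * c\<^sub>1 * (2 * c\<^sub>1 + 1)"
    "\<theta>\<^sub>4 \<le> (77 / 100) * c\<^sub>2 * (2 * c\<^sub>2 + 1)"
    by (simp_all add: \<open>\<theta>\<^sub>4 = _\<close> \<open>\<theta>\<^sub>3 = _\<close> min_le_iff_disj)
  interpret compressed_tracking E W F \<sigma> L\<^sub>f \<nu> r \<psi> \<phi>\<^sub>X \<phi>\<^sub>Y \<gamma> \<eta> c\<^sub>1 c\<^sub>2 C \<phi> \<theta>\<^sub>4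
    by unfold_locales (fact assms \<gamma>_bounds \<eta>_bounds \<theta>_bounds \<theta>_\<nu>)+
  show ?thesis
    using expected_gap_bound[OF \<open>randomized_map S cmp\<close> \<open>contractive_compressor S cmp r \<psi>\<close>
        \<open>prob_space M\<close> \<open>fresh_seeds M S \<zeta>\<close>]
    by (simp add: \<open>X = _\<close>)
qed

end
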